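(* For all hyperplane arrangements $\mathcal{A}$ (over an arbitrary field) we have $$\mathcal{N}_{\mathcal{A}}(Y,0)=\pi_{\mathcal{A}}(Y)$$ and, for all fields $\mathbb{F}$, $$\frac{\mathsf{cfHP}_{\mathcal{A}}(0,T)}{1-T}=\mathrm{Hilb}\left(\mathbb{F}[\Delta(\mathcal{L}(\mathcal{A}))],T\right).$$ In particular, the coefficients of both $\mathcal{N}_{\mathcal{A}}(Y,0)$ and $\mathcal{N}_{\mathcal{A}}(0,T)$ are nonnegative.
   Context: A hyperplane arrangement over a field $\mathbb{K}$ is a finite set $\mathcal{A}$ of affine hyperplanes in $\mathbb{K}^d$. $\mathcal{L}(\mathcal{A})$ is the set of all nonempty intersections of subsets of $\mathcal{A}$ (including $\mathbb{K}^d=\hat{0}$), ordered by reverse inclusion. $\widetilde{\mathcal{L}}(\mathcal{A})=\mathcal{L}(\mathcal{A})\setminus\{\hat{0}\}$. $\mathrm{rk}(x)$ is the supremum of lengths of chains from $\hat{0}$ to $x$; $\mathrm{rk}(\mathcal{A})$ is the rank of a maximal element. For a poset $P$, $\Delta(P)$ is its order complex: the simplicial complex on vertex set $P$ whose simplices are the flags $F=(x_1<\cdots<x_\ell)$, including the empty one; $|F|=\ell$. $\mathcal{A}_x=\{H\in\mathcal{A}\mid x\subseteq H\}$, $\mathcal{A}^x=\{x\cap H\mid H\in\mathcal{A}\setminus\mathcal{A}_x,\ x\cap H\neq\varnothing\}$ (an arrangement in $x$), $\mathcal{A}_\emptyset:=\mathcal{A}$ ($\emptyset$ a formal symbol), $\mathcal{A}^x_y:=(\mathcal{A}_y)^x$.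 $\pi_{\mathcal{A}}(Y)=\sum_{x\in\mathcal{L}(\mathcal{A})}\mu(\hat{0},x)(-Y)^{\mathrm{rk}(x)}$ with $\mu$ the Möbius function, and $\pi_F(Y)=\prod_{k=0}^\ell\pi_{\mathcal{A}^{x_k}_{x_{k+1}}}(Y)$ for $F=(x_1<\cdots<x_\ell)$, with $x_0=\hat{0}$, $x_{\ell+1}=\emptyset$. $\mathsf{cfHP}_{\mathcal{A}}(Y,T)=\sum_{F\in\Delta(\widetilde{\mathcal{L}}(\mathcal{A}))}\pi_F(Y)\left(\frac{T}{1-T}\right)^{|F|}$, and the polynomial $\mathcal{N}_{\mathcal{A}}(Y,T)\in\mathbb{Q}[Y,T]$ is defined by $\mathsf{cfHP}_{\mathcal{A}}(Y,T)=\mathcal{N}_{\mathcal{A}}(Y,T)/(1-T)^{\mathrm{rk}(\mathcal{A})}$. $\mathbb{F}[\Delta]$ is the Stanley–Reisner ring of a simplicial complex $\Delta$ and $\mathrm{Hilb}(\cdot,T)$ its (coarse, standard-graded) Hilbert series. *)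

theory Defs
  imports
    "Jordan_Normal_Form.Matrix"
    "HOL-Algebra.Embedded_Algebras"
    "HOL-Algebra.QuotRing"
    "HOL-Library.Poly_Mapping"
    "HOL-Computational_Algebra.Polynomial_FPS"
begin

section \<open>Posets of sets\<close>

text \<open>
  Every poset here is a set of sets ordered by reverse inclusion: \<open>x \<le> y\<close> in the poset means
  \<open>y \<subseteq> x\<close>. A flag \<open>x\<^sub>1 < \<dots> < x\<^sub>l\<close> is represented by its set of elements, so that \<open>|F| = card F\<close>.
\<close>

definition order_complex :: "'a set set \<Rightarrow> 'a set set set" where
  "order_complex P = {F \<in> chains P. finite F}"

text \<open>\<open>mobius P x y\<close> is the Moebius function \<open>\<mu>(x, y)\<close> of a finite poset \<open>P\<close> (junk value 0 for
  infinite \<open>P\<close>).\<close>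

function mobius :: "'a set set \<Rightarrow> 'a set \<Rightarrow> 'a set \<Rightarrow> int" where
  "mobius P x y =
    (if \<not> finite P then 0
     else if x = y then 1
     else if y \<subset> x then - (\<Sum>z \<in> {z \<in> P. y \<subset> z \<and> z \<subseteq> x}. mobius P x z)
     else 0)"
  by pat_completeness auto
termination
proof (relation "measure (\<lambda>(P, x, y). card {w \<in> P. y \<subset> w})")
  fix P :: "'a set set" and x y z
  assume "\<not> \<not> finite P" and z: "z \<in> {z \<in> P. y \<subset> z \<and> z \<subseteq> x}"
  then have "{w \<in> P. z \<subset> w} \<subset> {w \<in> P. y \<subset> w}" and "finite {w \<in> P. y \<subset> w}"
    by auto
  then show "((P, x, z), (P, x, y)) \<in> measure (\<lambda>(P, x, y). card {w \<in> P. y \<subset> w})"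
    by (simp add: psubset_card_mono)
qed simp

declare mobius.simps [simp del]

section \<open>Hyperplane arrangements\<close>

definition affine_hyperplane :: "nat \<Rightarrow> 'k::field vec set \<Rightarrow> bool" where
  "affine_hyperplane d H \<longleftrightarrow>
    (\<exists>a \<in> carrier_vec d. \<exists>b. a \<noteq> 0\<^sub>v d \<and> H = {v \<in> carrier_vec d. a \<bullet> v = b})"

definition hyperplane_arrangement :: "nat \<Rightarrow> 'k::field vec set set \<Rightarrow> bool" where
  "hyperplane_arrangement d A \<longleftrightarrow> finite A \<and> (\<forall>H \<in> A. affine_hyperplane d H)"

text \<open>
  The ambient space \<open>V\<close> of an arrangement \<open>A\<close> is an explicit argument: it is the whole space
  for the given arrangement, but \<open>x\<close> for a restriction to \<open>x\<close>. It is the bottom element of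
  \<open>flats V A\<close>, namely the intersection of the empty subset of \<open>A\<close>.
\<close>

definition flats :: "'v set \<Rightarrow> 'v set set \<Rightarrow> 'v set set" where
  "flats V A = {V \<inter> \<Inter>B | B. B \<subseteq> A} - {{}}"

definition proper_flats :: "'v set \<Rightarrow> 'v set set \<Rightarrow> 'v set set" where
  "proper_flats V A = flats V A - {V}"

definition rk :: "'v set \<Rightarrow> 'v set set \<Rightarrow> 'v set \<Rightarrow> nat" where
  "rk V A x = Sup {card C - 1 | C. C \<in> order_complex {y \<in> flats V A. x \<subseteq> y} \<and> V \<in> C \<and> x \<in> C}"

text \<open>Maximal in the intersection poset means minimal with respect to inclusion. For hyperplane
  arrangements all maximal elements have the same rank, so the choice is immaterial.\<close>

definition arr_rank :: "'v set \<Rightarrow> 'v set set \<Rightarrow> nat" where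
  "arr_rank V A = rk V A (SOME x. x \<in> flats V A \<and> (\<forall>y \<in> flats V A. \<not> y \<subset> x))"

definition poincare :: "'v set \<Rightarrow> 'v set set \<Rightarrow> rat poly" where
  "poincare V A = (\<Sum>x \<in> flats V A. of_int (mobius (flats V A) V x) * [:0, -1:] ^ rk V A x)"

text \<open>The formal symbol \<open>\<emptyset>\<close> is represented by the empty set, which is not a flat; then
  \<open>localization A {} = A\<close>, as required.\<close>

definition localization :: "'v set set \<Rightarrow> 'v set \<Rightarrow> 'v set set" where
  "localization A x = {H \<in> A. x \<subseteq> H}"

definition restriction :: "'v set set \<Rightarrow> 'v set \<Rightarrow> 'v set set" where
  "restriction A x = {x \<inter> H | H. H \<in> A - localization A x \<and> x \<inter> H \<noteq> {}}"

definition flag_list :: "'v set set \<Rightarrow> 'v set list" where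
  "flag_list F = (THE xs. set xs = F \<and> sorted_wrt (\<supset>) xs)"

definition flag_poincare :: "'v set \<Rightarrow> 'v set set \<Rightarrow> 'v set set \<Rightarrow> rat poly" where
  "flag_poincare V A F =
    (let xs = V # flag_list F @ [{}]
     in \<Prod>k \<le> card F. poincare (xs ! k) (restriction (localization A (xs ! Suc k)) (xs ! k)))"

text \<open>
  Rational functions in \<open>T\<close> whose denominator is a power of \<open>1 - T\<close> are read as formal power
  series in \<open>T\<close> (\<open>fps_X\<close>), where the Hilbert series also lives. Polynomials in \<open>Y\<close> and \<open>T\<close> have
  \<open>Y\<close> as the outer variable: \<open>cfHP\<close> is a polynomial in \<open>Y\<close> over the power series in \<open>T\<close>, and
  \<open>cfHP_numerator\<close> is a polynomial in \<open>Y\<close> over the polynomials in \<open>T\<close>.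
\<close>

definition cfHP :: "'v set \<Rightarrow> 'v set set \<Rightarrow> rat fps poly" where
  "cfHP V A = (\<Sum>F \<in> order_complex (proper_flats V A).
     smult ((fps_X / (1 - fps_X)) ^ card F) (map_poly fps_const (flag_poincare V A F)))"

definition cfHP_numerator :: "'v set \<Rightarrow> 'v set set \<Rightarrow> rat poly poly" where
  "cfHP_numerator V A = (THE N.
     cfHP V A = smult (1 / (1 - fps_X) ^ arr_rank V A) (map_poly fps_of_poly N))"

section \<open>Stanley-Reisner rings and Hilbert series\<close>

text \<open>Exponents of monomials in variables \<open>x\<^sub>v\<close> have type \<open>'v \<Rightarrow>\<^sub>0 nat\<close>; polynomials are finitely
  supported families of coefficients, with convolution as product.\<close>

type_synonym ('v, 'f) mvpoly = "('v \<Rightarrow>\<^sub>0 nat) \<Rightarrow>\<^sub>0 'f"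

definition poly_ring :: "'v set \<Rightarrow> ('v, 'f::field) mvpoly ring" where
  "poly_ring V = \<lparr>carrier = {p. \<forall>m \<in> Poly_Mapping.keys p. Poly_Mapping.keys m \<subseteq> V},
     mult = (*), one = 1, zero = 0, add = (+)\<rparr>"

definition homogeneous :: "'v set \<Rightarrow> nat \<Rightarrow> ('v, 'f::field) mvpoly set" where
  "homogeneous V n = {p \<in> carrier (poly_ring V).
     \<forall>m \<in> Poly_Mapping.keys p. (\<Sum>v \<in> Poly_Mapping.keys m. Poly_Mapping.lookup m v) = n}"

definition var :: "'v \<Rightarrow> ('v, 'f::field) mvpoly" where
  "var v = Poly_Mapping.single (Poly_Mapping.single v 1) 1"

text \<open>The vertex set of a simplicial complex \<open>\<Delta>\<close> (a set of finite sets) is \<open>\<Union>\<Delta>\<close>.\<close>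

definition sr_ideal :: "'v set set \<Rightarrow> ('v, 'f::field) mvpoly set" where
  "sr_ideal \<Delta> =
    Idl\<^bsub>poly_ring (\<Union>\<Delta>)\<^esub> {\<Prod>v \<in> \<sigma>. var v | \<sigma>. finite \<sigma> \<and> \<sigma> \<subseteq> \<Union>\<Delta> \<and> \<sigma> \<notin> \<Delta>}"

definition sr_ring :: "'v set set \<Rightarrow> ('v, 'f::field) mvpoly set ring" where
  "sr_ring \<Delta> = poly_ring (\<Union>\<Delta>) Quot sr_ideal \<Delta>"

definition sr_class :: "'v set set \<Rightarrow> ('v, 'f::field) mvpoly \<Rightarrow> ('v, 'f) mvpoly set" where
  "sr_class \<Delta> p = sr_ideal \<Delta> +>\<^bsub>poly_ring (\<Union>\<Delta>)\<^esub> p"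

definition sr_scalars :: "'v set set \<Rightarrow> ('v, 'f::field) mvpoly set set" where
  "sr_scalars \<Delta> = sr_class \<Delta> ` {Poly_Mapping.single 0 c | c. True}"

definition sr_component :: "'v set set \<Rightarrow> nat \<Rightarrow> ('v, 'f::field) mvpoly set set" where
  "sr_component \<Delta> n = sr_class \<Delta> ` homogeneous (\<Union>\<Delta>) n"

text \<open>Hilbert series of a ring \<open>R\<close> containing the field \<open>K\<close>, with graded components \<open>E n\<close>.\<close>

definition hilbert_series :: "'r ring \<Rightarrow> 'r set \<Rightarrow> (nat \<Rightarrow> 'r set) \<Rightarrow> rat fps" where
  "hilbert_series R K E = Abs_fps (\<lambda>n. of_nat ((ring.dim R over K) (E n)))"

definition sr_hilbert_series :: "'f::field itself \<Rightarrow> 'v set set \<Rightarrow> rat fps" where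
  "sr_hilbert_series _ \<Delta> = hilbert_series
     (sr_ring \<Delta> :: ('v, 'f) mvpoly set ring) (sr_scalars \<Delta>) (sr_component \<Delta>)"

end

theory Submission
  imports Defs
begin

text \<open>
  Write \<open>T\<close> for the variable of the power series, \<open>r\<close> for the rank of the arrangement, and \<open>L\<close> for its
  intersection poset.

  A flag of \<open>k\<close> proper flats has \<open>k \<le> r\<close>, and \<open>(T / (1 - T)) ^ k * (1 - T) ^ r\<close> is then the polynomial
  \<open>T ^ k * (1 - T) ^ (r - k)\<close> (\<open>face_weight\<close>). So the numerator is the sum of the flag Poincare polynomials
  with these weights (\<open>cfHP_numerator_eq\<close>). At \<open>T = 0\<close> only the empty flag survives, and it contributes the
  Poincare polynomial of the arrangement. That this polynomial has nonnegative coefficients is the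
  alternation of signs of the Moebius function, which follows from Weisner's theorem (\<open>mu_sign\<close>).

  At \<open>Y = 0\<close> each Poincare polynomial is \<open>1\<close>. Hence \<open>cfHP\<close> becomes the sum of \<open>(T / (1 - T)) ^ |F|\<close> over the
  faces \<open>F\<close> of the order complex of the proper flats. The order complex of \<open>L\<close> is the cone over this complex
  with the whole space as apex, so the corresponding sum for \<open>L\<close> is larger by the factor \<open>1 / (1 - T)\<close>. It is
  the Hilbert series of the Stanley-Reisner ring because the monomials supported on faces form a basis
  of that ring (\<open>dimension_face_supported\<close>), and those of support \<open>\<sigma>\<close> are counted by
  \<open>(T / (1 - T)) ^ |\<sigma>|\<close> (\<open>card_monomials\<close>).

  The numerator at \<open>Y = 0\<close> is the h-polynomial of the order complex of the proper flats. Its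
  nonnegativity is the deepest part (\<open>h_within_bounds\<close>). The hyperplanes may have empty intersection, so \<open>L\<close>
  is in general only a geometric semilattice and not a geometric lattice. The proof is a shelling argument
  carried out on h-polynomials alone. For a set \<open>E\<close> of hyperplanes consider the flags all of whose members
  lie in a common hyperplane of \<open>E\<close>. Enlarging \<open>E\<close> by one hyperplane \<open>H\<close> changes the h-polynomial by an
  expression in the h-polynomials of the restriction to \<open>H\<close> (\<open>h_within_insert\<close>), which is nonnegative by
  induction provided that \<open>E\<close> induces on \<open>H\<close> a set of the same kind. This is ensured by
  adding the hyperplanes through one fixed minimal flat before all others (\<open>initial_segment\<close>).
\<close>


section \<open>Linear algebra of flats\<close>

text \<open>The hyperplanes crossing a flat \<open>x\<close> are those that cut out the covers of \<open>x\<close> in the intersection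
  poset; any other hyperplane contains \<open>x\<close> or is parallel to it.\<close>

definition crosses :: "'v set \<Rightarrow> 'v set \<Rightarrow> bool" where
  "crosses H x \<longleftrightarrow> x \<inter> H \<noteq> {} \<and> \<not> x \<subseteq> H"

text \<open>
  All that the combinatorics uses of linear algebra is contained in two assumptions; together they take
  the place of a dimension function. By \<open>cover\<close>, two hyperplanes of a flat are never strictly nested.
  The meaning of \<open>parallel\<close> is this: if no member of \<open>B\<close> crosses \<open>y\<close>, then every direction of \<open>y\<close> is a
  direction of \<open>x \<inter> \<Inter>B\<close>, and a hyperplane transverse to some direction of \<open>y\<close> crosses every flat that has
  this direction.
\<close>
locale affine_arrangement =
  fixes V :: "'v set" and A :: "'v set set"
  assumes finite_hyperplanes: "finite A"
    and ambient_nonempty: "V \<noteq> {}"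
    and hyperplane_proper: "H \<in> A \<Longrightarrow> H \<noteq> {} \<and> H \<subset> V"
    and cover: "\<lbrakk>x \<in> flats V A; H \<in> A; H' \<in> A; crosses H x; crosses H' x; x \<inter> H \<subseteq> H'\<rbrakk>
      \<Longrightarrow> x \<inter> H' \<subseteq> H"
    and parallel: "\<lbrakk>x \<in> flats V A; y \<in> flats V A; y \<subseteq> x; B \<subseteq> A; x \<inter> \<Inter>B \<noteq> {};
        \<And>H. H \<in> B \<Longrightarrow> \<not> crosses H y; G \<in> A; crosses G y\<rbrakk>
      \<Longrightarrow> crosses G (x \<inter> \<Inter>B)"

lemma scalar_prod_line:
  fixes a :: "'k::field vec"
  assumes "a \<in> carrier_vec d" "p \<in> carrier_vec d" "q \<in> carrier_vec d" "s \<in> carrier_vec d"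
  shows "a \<bullet> (s + c \<cdot>\<^sub>v (p - q)) = a \<bullet> s + c * (a \<bullet> p - a \<bullet> q)"
  using assms by (simp add: scalar_prod_add_distrib[of _ d] scalar_prod_minus_distrib[of _ d])

context
  fixes d :: nat and A :: "'k::field vec set set"
  assumes arrangement: "hyperplane_arrangement d A"
begin

lemma hyperplane_equation:
  assumes "H \<in> A"
  obtains a b where "a \<in> carrier_vec d" "a \<noteq> 0\<^sub>v d" "H = {v \<in> carrier_vec d. a \<bullet> v = b}"
  using assms arrangement unfolding hyperplane_arrangement_def affine_hyperplane_def by blast

lemma flat_subset_carrier: "x \<in> flats (carrier_vec d) A \<Longrightarrow> x \<subseteq> carrier_vec d"
  unfolding flats_def by auto

lemma line_in_flat:
  assumes x: "x \<in> flats (carrier_vec d) A" and pts: "p \<in> x" "q \<in> x" "s \<in> x"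
  shows "s + c \<cdot>\<^sub>v (p - q) \<in> x"
proof -
  obtain B where B: "B \<subseteq> A" "x = carrier_vec d \<inter> \<Inter>B"
    using x unfolding flats_def by auto
  have car: "p \<in> carrier_vec d" "q \<in> carrier_vec d" "s \<in> carrier_vec d"
    using flat_subset_carrier[OF x] pts by auto
  have "s + c \<cdot>\<^sub>v (p - q) \<in> H" if "H \<in> B" for H
  proof -
    obtain a b where ab: "a \<in> carrier_vec d" "H = {v \<in> carrier_vec d. a \<bullet> v = b}"
      using hyperplane_equation B \<open>H \<in> B\<close> by (metis subsetD)
    moreover have "p \<in> H" "q \<in> H" "s \<in> H" using B pts that by auto
    ultimately show ?thesis using scalar_prod_line[OF ab(1) car] by auto
  qed
  then show ?thesis using B car by auto
qed

text \<open>If the form took two values on \<open>x\<close>, then on the line through the two points it would take every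
  value, so that the hyperplane would meet \<open>x\<close> without containing it.\<close>
lemma not_crosses_constant:
  assumes x: "x \<in> flats (carrier_vec d) A"
    and a: "a \<in> carrier_vec d" "H = {v \<in> carrier_vec d. a \<bullet> v = b}"
    and no: "\<not> crosses H x" and pts: "p \<in> x" "q \<in> x"
  shows "a \<bullet> p = a \<bullet> q"
proof (rule ccontr)
  assume ne: "a \<bullet> p \<noteq> a \<bullet> q"
  have car: "p \<in> carrier_vec d" "q \<in> carrier_vec d"
    using flat_subset_carrier[OF x] pts by auto
  define c where "c = (b - a \<bullet> q) / (a \<bullet> p - a \<bullet> q)"
  have "a \<bullet> (q + c \<cdot>\<^sub>v (p - q)) = b"
    using ne unfolding scalar_prod_line[OF a(1) car car(2)] c_def by simp
  moreover have "q + c \<cdot>\<^sub>v (p - q) \<in> x" by (rule line_in_flat[OF x pts pts(2)])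
  ultimately have "x \<inter> H \<noteq> {}" using a(2) flat_subset_carrier[OF x] by blast
  then have "x \<subseteq> H" using no by (simp add: crosses_def)
  then show False using a(2) pts ne by auto
qed

lemma cover_flats:
  assumes x: "x \<in> flats (carrier_vec d) A" and H: "H \<in> A" "H' \<in> A"
    and cr: "crosses H x" "crosses H' x" and sub: "x \<inter> H \<subseteq> H'"
  shows "x \<inter> H' \<subseteq> H"
proof (rule ccontr)
  assume "\<not> x \<inter> H' \<subseteq> H"
  then obtain v where v: "v \<in> x" "v \<in> H'" "v \<notin> H" by blast
  obtain p where p: "p \<in> x" "p \<in> H" "p \<in> H'" using cr(1) sub unfolding crosses_def by blast
  obtain q where q: "q \<in> x" "q \<notin> H'" using cr(2) unfolding crosses_def by blast
  obtain a b where ab: "a \<in> carrier_vec d" "H = {v \<in> carrier_vec d. a \<bullet> v = b}"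
    using hyperplane_equation H by metis
  obtain a' b' where ab': "a' \<in> carrier_vec d" "H' = {v \<in> carrier_vec d. a' \<bullet> v = b'}"
    using hyperplane_equation H by metis
  have car: "v \<in> carrier_vec d" "p \<in> carrier_vec d" "q \<in> carrier_vec d"
    using flat_subset_carrier[OF x] v p q by auto
  \<comment> \<open>Both \<open>p\<close> and \<open>v\<close> lie on \<open>H'\<close>, so moving from \<open>q\<close> in the direction \<open>v - p\<close> stays off \<open>H'\<close>; but it reaches \<open>H\<close>.\<close>
  define c where "c = (b - a \<bullet> q) / (a \<bullet> v - a \<bullet> p)"
  define w where "w = q + c \<cdot>\<^sub>v (v - p)"
  have ne: "a \<bullet> v \<noteq> a \<bullet> p" using v p ab car by auto
  have w: "w \<in> x" unfolding w_def by (rule line_in_flat[OF x v(1) p(1) q(1)])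
  have "a \<bullet> w = b" using ne unfolding w_def scalar_prod_line[OF ab(1) car] c_def by simp
  then have "w \<in> H'" using w ab sub flat_subset_carrier[OF x] by blast
  moreover have "a' \<bullet> w = a' \<bullet> q"
    using v p ab' unfolding w_def scalar_prod_line[OF ab'(1) car] by auto
  ultimately show False using ab' q car by auto
qed

lemma parallel_flats:
  assumes x: "x \<in> flats (carrier_vec d) A" and y: "y \<in> flats (carrier_vec d) A" "y \<subseteq> x"
    and B: "B \<subseteq> A" "x \<inter> \<Inter>B \<noteq> {}" "\<And>H. H \<in> B \<Longrightarrow> \<not> crosses H y"
    and G: "G \<in> A" "crosses G y"
  shows "crosses G (x \<inter> \<Inter>B)"
proof (rule ccontr)
  let ?z = "x \<inter> \<Inter>B"
  assume no: "\<not> crosses G ?z"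
  obtain g c where g: "g \<in> carrier_vec d" "G = {v \<in> carrier_vec d. g \<bullet> v = c}"
    using hyperplane_equation G by metis
  obtain p q where pq: "p \<in> y" "p \<in> G" "q \<in> y" "q \<notin> G" using G unfolding crosses_def by blast
  obtain s where s: "s \<in> ?z" using B by blast
  have car: "p \<in> carrier_vec d" "q \<in> carrier_vec d" "s \<in> carrier_vec d"
    using flat_subset_carrier[OF x] y pq s by auto
  have ne: "g \<bullet> p \<noteq> g \<bullet> q" using pq g car by auto
  obtain B0 where B0: "B0 \<subseteq> A" "x = carrier_vec d \<inter> \<Inter>B0"
    using x unfolding flats_def by auto
  have "?z = carrier_vec d \<inter> \<Inter>(B0 \<union> B)" using B0 by auto
  then have z: "?z \<in> flats (carrier_vec d) A" using B(1,2) B0(1) unfolding flats_def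
    by (intro DiffI CollectI exI[of _ "B0 \<union> B"]) auto
  \<comment> \<open>The forms of \<open>B\<close> are constant on \<open>y\<close>, so translating by the direction \<open>p - q\<close> of \<open>y\<close> preserves \<open>x \<inter> \<Inter>B\<close>,
    while it changes the value of the form of \<open>G\<close>.\<close>
  define w where "w = s + 1 \<cdot>\<^sub>v (p - q)"
  have "w \<in> x" unfolding w_def using line_in_flat[OF x] pq y s by blast
  moreover have "w \<in> H" if H: "H \<in> B" for H
  proof -
    obtain a b where ab: "a \<in> carrier_vec d" "H = {v \<in> carrier_vec d. a \<bullet> v = b}"
      using hyperplane_equation B H by (metis subsetD)
    have "a \<bullet> p = a \<bullet> q" by (rule not_crosses_constant[OF y(1) ab B(3)[OF H] pq(1,3)])
    then have "a \<bullet> w = a \<bullet> s" unfolding w_def scalar_prod_line[OF ab(1) car] by simp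
    moreover have "s \<in> H" using s H by auto
    ultimately show ?thesis using ab car unfolding w_def by auto
  qed
  ultimately have "w \<in> ?z" by auto
  from not_crosses_constant[OF z g no this s] show False
    using ne unfolding w_def scalar_prod_line[OF g(1) car] by simp
qed

lemma affine_arrangement_carrier_vec: "affine_arrangement (carrier_vec d) A"
proof
  show "finite A" using arrangement by (simp add: hyperplane_arrangement_def)
  show "carrier_vec d \<noteq> ({} :: 'k vec set)" using zero_carrier_vec by blast
  fix H assume "H \<in> A"
  then obtain a b where ab: "a \<in> carrier_vec d" "a \<noteq> 0\<^sub>v d" "H = {v \<in> carrier_vec d. a \<bullet> v = b}"
    by (rule hyperplane_equation)
  obtain i where i: "i < d" "a $ i \<noteq> 0"
    using ab(1,2) eq_vecI[of a "0\<^sub>v d"] by auto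
  have dot: "a \<bullet> (c \<cdot>\<^sub>v unit_vec d i) = c * a $ i" for c using ab(1) i(1) by simp
  have car: "c \<cdot>\<^sub>v unit_vec d i \<in> carrier_vec d" for c :: 'k by simp
  have "(b / a $ i) \<cdot>\<^sub>v unit_vec d i \<in> H" using dot i(2) car ab(3) by auto
  moreover have "((b + 1) / a $ i) \<cdot>\<^sub>v unit_vec d i \<notin> H" using dot i(2) car ab(3) by auto
  ultimately show "H \<noteq> {} \<and> H \<subset> carrier_vec d" using ab(3) car by blast
next
  show "x \<inter> H' \<subseteq> H"
    if "x \<in> flats (carrier_vec d) A" "H \<in> A" "H' \<in> A" "crosses H x" "crosses H' x" "x \<inter> H \<subseteq> H'"
    for x H H' using that by (rule cover_flats)
next
  show "crosses G (x \<inter> \<Inter>B)"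
    if "x \<in> flats (carrier_vec d) A" "y \<in> flats (carrier_vec d) A" "y \<subseteq> x" "B \<subseteq> A"
      "x \<inter> \<Inter>B \<noteq> {}" "\<And>H. H \<in> B \<Longrightarrow> \<not> crosses H y" "G \<in> A" "crosses G y"
    for x y B G using that by (rule parallel_flats)
qed

end


section \<open>Flags, depth and rank\<close>

definition below :: "'a set set \<Rightarrow> 'a set \<Rightarrow> 'a set set" where
  "below P x = {y \<in> P. y \<subset> x}"

lemma mem_order_complex:
  "F \<in> order_complex P \<longleftrightarrow> F \<subseteq> P \<and> finite F \<and> (\<forall>x \<in> F. \<forall>y \<in> F. x \<subseteq> y \<or> y \<subseteq> x)"
  by (auto simp: order_complex_def chains_def chain_subset_def)

lemma finite_order_complex: "finite P \<Longrightarrow> finite (order_complex P)"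
  by (rule finite_subset[of _ "Pow P"]) (auto simp: mem_order_complex)

lemma order_complex_mono: "P \<subseteq> Q \<Longrightarrow> order_complex P \<subseteq> order_complex Q"
  unfolding mem_order_complex subset_iff by blast

lemma empty_flag: "{} \<in> order_complex P"
  by (simp add: mem_order_complex)

lemma insert_top_flag:
  "\<lbrakk>F \<in> order_complex P; x \<in> P; \<And>y. y \<in> F \<Longrightarrow> y \<subseteq> x\<rbrakk> \<Longrightarrow> insert x F \<in> order_complex P"
  by (auto simp: mem_order_complex)

lemma Union_flag_mem:
  assumes "F \<in> order_complex P" "F \<noteq> {}"
  shows "\<Union>F \<in> F"
proof -
  have "finite F" and lin: "\<forall>x \<in> F. \<forall>y \<in> F. x \<subseteq> y \<or> y \<subseteq> x"
    using assms(1) by (auto simp: mem_order_complex)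
  from this(1) assms(2) lin show ?thesis
  proof (induction F rule: finite_ne_induct)
    case (insert x F)
    then have "\<Union>F \<in> F" by blast
    then have "x \<subseteq> \<Union>F \<or> \<Union>F \<subseteq> x" using insert.prems by blast
    then show ?case using \<open>\<Union>F \<in> F\<close> by (metis Union_insert insertCI sup.absorb1 sup.absorb2)
  qed simp
qed

context affine_arrangement
begin

abbreviation "L \<equiv> flats V A"

abbreviation flags :: "'v set \<Rightarrow> 'v set set set" where
  "flags x \<equiv> order_complex (below L x)"

text \<open>The rank of the restriction of the arrangement to \<open>x\<close>, by \<open>depth_Int_hyperplane\<close>; the number
  \<open>depth V - depth x\<close> is the rank of \<open>x\<close> itself (\<open>rk_plus_depth\<close>).\<close>
definition depth :: "'v set \<Rightarrow> nat" where
  "depth x = Max (card ` flags x)"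

definition minimal_flat :: "'v set \<Rightarrow> bool" where
  "minimal_flat m \<longleftrightarrow> m \<in> L \<and> (\<forall>H \<in> A. \<not> crosses H m)"

lemma finite_flats: "finite L"
proof -
  have "L \<subseteq> (\<lambda>B. V \<inter> \<Inter>B) ` Pow A" unfolding flats_def by auto
  then show ?thesis using finite_hyperplanes by (meson finite_Pow_iff finite_imageI finite_subset)
qed

lemma flatD: "x \<in> L \<Longrightarrow> x \<noteq> {}" "x \<in> L \<Longrightarrow> x \<subseteq> V"
  by (auto simp: flats_def)

lemma ambient_flat: "V \<in> L"
  using ambient_nonempty unfolding flats_def by (auto intro!: exI[of _ "{}"])

lemma flat_Inter:
  assumes "x \<in> L" "B \<subseteq> A" "x \<inter> \<Inter>B \<noteq> {}"
  shows "x \<inter> \<Inter>B \<in> L"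
proof -
  obtain C where C: "C \<subseteq> A" "x = V \<inter> \<Inter>C" using assms(1) unfolding flats_def by auto
  then have "x \<inter> \<Inter>B = V \<inter> \<Inter>(C \<union> B)" by auto
  then show ?thesis using assms(2,3) C(1) unfolding flats_def
    by (intro DiffI CollectI exI[of _ "C \<union> B"]) auto
qed

lemma flat_Int: "\<lbrakk>x \<in> L; H \<in> A; x \<inter> H \<noteq> {}\<rbrakk> \<Longrightarrow> x \<inter> H \<in> L"
  using flat_Inter[of x "{H}"] by simp

lemma crosses_flat:
  assumes "x \<in> L" "H \<in> A" "crosses H x"
  shows "x \<inter> H \<in> L" "x \<inter> H \<subset> x"
  using assms flat_Int by (auto simp: crosses_def)

lemma crossing_hyperplane_above:
  assumes "x \<in> L" "y \<in> L" "y \<subset> x"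
  obtains H where "H \<in> A" "crosses H x" "y \<subseteq> H"
proof -
  obtain B where B: "B \<subseteq> A" "y = V \<inter> \<Inter>B" using assms(2) unfolding flats_def by auto
  have "\<not> x \<subseteq> \<Inter>B" using assms(3) B flatD(2)[OF assms(1)] by blast
  then obtain H where "H \<in> B" "\<not> x \<subseteq> H" by blast
  then show ?thesis using that[of H] B assms(3) flatD(1)[OF assms(2)] unfolding crosses_def by blast
qed

lemma cover_eq:
  assumes "x \<in> L" "H \<in> A" "H' \<in> A" "crosses H x" "crosses H' x" "x \<inter> H \<subseteq> H'"
  shows "x \<inter> H = x \<inter> H'"
  using cover[OF assms] assms(6) by blast

lemma crosses_mono:
  assumes "x \<in> L" "y \<in> L" "y \<subseteq> x" "G \<in> A" "crosses G y"
  shows "crosses G x"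
  using parallel[of x y "{}" G] assms flatD(1)[of x] by auto

lemma below_mono: "\<lbrakk>x \<in> L; y \<in> L; y \<subset> x\<rbrakk> \<Longrightarrow> below L y \<subset> below L x"
  unfolding below_def by blast

lemma flat_induct [consumes 1, case_names flat]:
  assumes "x \<in> L" and step: "\<And>x. \<lbrakk>x \<in> L; \<And>y. \<lbrakk>y \<in> L; y \<subset> x\<rbrakk> \<Longrightarrow> P y\<rbrakk> \<Longrightarrow> P x"
  shows "P x"
  using assms(1)
proof (induction "card (below L x)" arbitrary: x rule: less_induct)
  case less
  have "finite (below L x)" using finite_flats unfolding below_def by simp
  then have "card (below L y) < card (below L x)" if "y \<in> L" "y \<subset> x" for y
    using below_mono[OF less.prems that] by (simp add: psubset_card_mono)
  then show ?case using less step by blast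
qed

lemma finite_flags: "finite (flags x)"
  using finite_flats by (intro finite_order_complex) (simp add: below_def)

lemma Union_flag_flat:
  assumes "F \<in> flags x" "F \<noteq> {}"
  shows "\<Union>F \<in> L" "\<Union>F \<subset> x"
proof -
  have "\<Union>F \<in> below L x" using Union_flag_mem[OF assms] assms(1) by (auto simp: mem_order_complex)
  then show "\<Union>F \<in> L" "\<Union>F \<subset> x" by (simp_all add: below_def)
qed

lemma card_flag_le_depth: "F \<in> flags x \<Longrightarrow> card F \<le> depth x"
  unfolding depth_def using finite_flags by simp

lemma depth_attained: obtains F where "F \<in> flags x" "card F = depth x"
proof -
  have "depth x \<in> card ` flags x"
    unfolding depth_def using finite_flags empty_flag by (intro Max_in) auto
  then show ?thesis using that by auto
qed

lemma insert_flag: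
  assumes "x \<in> L" "y \<in> L" "y \<subset> x" "F \<in> flags y"
  shows "insert y F \<in> flags x" "y \<notin> F"
  using assms by (auto simp: mem_order_complex below_def)

lemma depth_less:
  assumes "x \<in> L" "y \<in> L" "y \<subset> x"
  shows "depth y < depth x"
proof -
  obtain F where F: "F \<in> flags y" "card F = depth y" by (rule depth_attained)
  have "finite F" using F(1) by (simp add: mem_order_complex)
  then show ?thesis
    using insert_flag[OF assms F(1)] card_flag_le_depth[of "insert y F" x] F(2) by simp
qed

lemma minimal_flat_depth: "minimal_flat m \<Longrightarrow> depth m = 0"
proof -
  assume m: "minimal_flat m"
  have "below L m = {}"
    using m crossing_hyperplane_above unfolding minimal_flat_def below_def by blast
  then show ?thesis using card_flag_le_depth depth_attained[of m]
    by (metis card.empty mem_order_complex subset_empty)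
qed

lemma minimal_flat_iff: "minimal_flat m \<longleftrightarrow> m \<in> L \<and> (\<forall>y \<in> L. \<not> y \<subset> m)"
proof
  assume m: "minimal_flat m"
  then show "m \<in> L \<and> (\<forall>y \<in> L. \<not> y \<subset> m)"
    using crossing_hyperplane_above[of m] unfolding minimal_flat_def by blast
next
  assume m: "m \<in> L \<and> (\<forall>y \<in> L. \<not> y \<subset> m)"
  have "\<not> crosses H m" if "H \<in> A" for H using crosses_flat[of m H] m that by auto
  then show "minimal_flat m" using m by (simp add: minimal_flat_def)
qed

lemma minimal_flat_below:
  assumes "x \<in> L"
  obtains m where "minimal_flat m" "m \<subseteq> x"
proof -
  have "\<exists>m. minimal_flat m \<and> m \<subseteq> x" using assms
  proof (induction x rule: flat_induct)
    case (flat x)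
    then show ?case unfolding minimal_flat_iff by (metis dual_order.refl dual_order.trans psubset_imp_subset)
  qed
  then show ?thesis using that by blast
qed

text \<open>
  All covers of \<open>x\<close> have the same depth, by a Jordan-Hoelder argument. Two distinct covers that meet have their
  intersection as a common cover, to which the induction hypothesis applies. Two disjoint covers are
  compared through a third one: a hyperplane crossing one of them crosses, by parallelism, the other
  as well, so the cover of \<open>x\<close> which it cuts out meets both.
\<close>
lemma depth_Int_hyperplane:
  assumes "x \<in> L" "H \<in> A" "crosses H x"
  shows "depth x = Suc (depth (x \<inter> H))"
  using assms
proof (induction x arbitrary: H rule: flat_induct)
  case (flat x)
  have meeting: "depth (x \<inter> G) = depth (x \<inter> G')"
    if G: "G \<in> A" "crosses G x" and G': "G' \<in> A" "crosses G' x" and ne: "x \<inter> G \<inter> G' \<noteq> {}"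
    for G G'
  proof (cases "x \<inter> G \<subseteq> G' \<or> x \<inter> G' \<subseteq> G")
    case True
    then show ?thesis using cover_eq[OF flat.hyps] G G' by metis
  next
    case False
    have "crosses G' (x \<inter> G)" "crosses G (x \<inter> G')"
      using False ne unfolding crosses_def by auto
    then have "depth (x \<inter> G) = Suc (depth (x \<inter> G \<inter> G'))" "depth (x \<inter> G') = Suc (depth (x \<inter> G' \<inter> G))"
      using flat.IH crosses_flat[OF flat.hyps] G G' by auto
    then show ?thesis by (simp add: Int_ac)
  qed
  have through: "depth (x \<inter> G) = depth (x \<inter> G')"
    if G: "G \<in> A" "crosses G x" and G': "G' \<in> A" "crosses G' x" and disj: "x \<inter> G \<inter> G' = {}"
      and K: "K \<in> A" "crosses K (x \<inter> G)" for G G' K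
  proof -
    note GL = crosses_flat[OF flat.hyps G]
    have "\<not> crosses G' (x \<inter> G)" using disj by (auto simp: crosses_def)
    then have "crosses K (x \<inter> \<Inter>{G'})"
      using G' K GL by (intro parallel[OF flat.hyps GL(1)]) (auto simp: crosses_def)
    then have "x \<inter> K \<inter> G' \<noteq> {}" unfolding crosses_def by auto
    moreover have "x \<inter> G \<inter> K \<noteq> {}" using K unfolding crosses_def by auto
    moreover have "crosses K x" using crosses_mono[OF flat.hyps GL(1)] K GL by auto
    ultimately show ?thesis using meeting G G' K(1) by metis
  qed
  have same: "depth (x \<inter> G) = depth (x \<inter> G')"
    if G: "G \<in> A" "crosses G x" and G': "G' \<in> A" "crosses G' x" for G G'
  proof (cases "x \<inter> G \<inter> G' = {}")
    case False
    then show ?thesis using meeting that by blast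
  next
    case disj: True
    then have disj': "x \<inter> G' \<inter> G = {}" by blast
    show ?thesis
    proof (cases "minimal_flat (x \<inter> G) \<and> minimal_flat (x \<inter> G')")
      case True
      then show ?thesis using minimal_flat_depth by simp
    next
      case False
      then consider K where "K \<in> A" "crosses K (x \<inter> G)" | K where "K \<in> A" "crosses K (x \<inter> G')"
        using crosses_flat[OF flat.hyps] G G' unfolding minimal_flat_def by blast
      then show ?thesis using through[OF G G' disj] through[OF G' G disj'] by metis
    qed
  qed
  note HL = crosses_flat[OF flat.hyps flat.prems]
  obtain F where F: "F \<in> flags x" "card F = depth x" by (rule depth_attained)
  have less: "depth (x \<inter> H) < depth x" using depth_less[OF flat.hyps HL] .
  then have "F \<noteq> {}" using F(2) by auto
  then have top: "\<Union>F \<in> F" using Union_flag_mem F(1) by blast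
  note U = Union_flag_flat[OF F(1) \<open>F \<noteq> {}\<close>]
  then obtain G where G: "G \<in> A" "crosses G x" "\<Union>F \<subseteq> G"
    using crossing_hyperplane_above[OF flat.hyps] by blast
  have "F - {\<Union>F} \<in> flags (x \<inter> G)"
    unfolding mem_order_complex
  proof (intro conjI ballI subsetI)
    fix y assume y: "y \<in> F - {\<Union>F}"
    then have "y \<in> L" "y \<subset> \<Union>F" using F(1) by (auto simp: mem_order_complex below_def)
    then show "y \<in> below L (x \<inter> G)" using U(2) G(3) unfolding below_def by blast
  qed (use F(1) in \<open>auto simp: mem_order_complex\<close>)
  then have "card (F - {\<Union>F}) \<le> depth (x \<inter> G)" by (rule card_flag_le_depth)
  moreover have "finite F" using F(1) by (simp add: mem_order_complex)
  ultimately have "depth x \<le> Suc (depth (x \<inter> G))" using F(2) top by simp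
  then show ?case using less same[OF flat.prems G(1,2)] by linarith
qed

lemma saturated_chain:
  assumes "x \<in> L" "y \<in> L" "y \<subseteq> x"
  obtains C where "C \<in> order_complex {z \<in> L. y \<subseteq> z \<and> z \<subseteq> x}" "x \<in> C" "y \<in> C"
    "card C + depth y = Suc (depth x)"
proof -
  have "\<exists>C \<in> order_complex {z \<in> L. y \<subseteq> z \<and> z \<subseteq> x}. x \<in> C \<and> y \<in> C \<and> card C + depth y = Suc (depth x)"
    using assms(1,3)
  proof (induction x rule: flat_induct)
    case (flat x)
    show ?case
    proof (cases "y = x")
      case True
      then show ?thesis using assms(2) by (intro bexI[of _ "{x}"]) (auto simp: mem_order_complex)
    next
      case False
      then obtain H where H: "H \<in> A" "crosses H x" "y \<subseteq> H"
        using crossing_hyperplane_above[OF flat.hyps assms(2)] flat.prems by blast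
      note HL = crosses_flat[OF flat.hyps H(1,2)]
      obtain C where C: "C \<in> order_complex {z \<in> L. y \<subseteq> z \<and> z \<subseteq> x \<inter> H}" "y \<in> C"
        "card C + depth y = Suc (depth (x \<inter> H))"
        using flat.IH[OF HL] H(3) flat.prems by auto
      have "insert x C \<in> order_complex {z \<in> L. y \<subseteq> z \<and> z \<subseteq> x}"
        using C(1) flat.hyps flat.prems by (intro insert_top_flag) (auto simp: mem_order_complex)
      moreover have "finite C" "x \<notin> C" using C(1) HL(2) unfolding mem_order_complex by blast+
      ultimately show ?thesis
        using C depth_Int_hyperplane[OF flat.hyps H(1,2)] by (intro bexI[of _ "insert x C"]) auto
    qed
  qed
  then show ?thesis using that by blast
qed

lemma chain_length_le:
  assumes "C \<in> order_complex {z \<in> L. y \<subseteq> z}" "y \<in> L"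
  shows "card C + depth y \<le> Suc (depth V)"
proof -
  have le: "depth z \<le> depth x" if "x \<in> L" "z \<in> L" "z \<subseteq> x" for x z
    using depth_less[of x z] that by (cases "z = x") (auto simp: psubset_eq)
  have C: "C \<subseteq> L" "finite C" and lin: "\<And>x z. x \<in> C \<Longrightarrow> z \<in> C \<Longrightarrow> x \<subseteq> z \<or> z \<subseteq> x"
    using assms(1) unfolding mem_order_complex by auto
  have "inj_on depth C"
  proof (rule inj_onI)
    fix x z assume "x \<in> C" "z \<in> C" "depth x = depth z"
    then show "x = z" using lin[of x z] depth_less[of x z] depth_less[of z x] C(1) by fastforce
  qed
  moreover have "depth ` C \<subseteq> {depth y..depth V}"
  proof (rule image_subsetI)
    fix z assume "z \<in> C"
    then have "z \<in> L" "y \<subseteq> z" using assms(1) unfolding mem_order_complex by auto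
    then show "depth z \<in> {depth y..depth V}"
      using le[OF _ assms(2)] le[OF ambient_flat] flatD(2) by simp
  qed
  ultimately have "card C \<le> card {depth y..depth V}"
    using card_inj_on_le by blast
  moreover have "depth y \<le> depth V" using le[OF ambient_flat assms(2)] flatD(2) assms(2) by blast
  ultimately show ?thesis by simp
qed

lemma rk_plus_depth:
  assumes "x \<in> L"
  shows "rk V A x + depth x = depth V"
proof -
  let ?S = "{card C - 1 | C. C \<in> order_complex {y \<in> L. x \<subseteq> y} \<and> V \<in> C \<and> x \<in> C}"
  obtain C where C: "C \<in> order_complex {z \<in> L. x \<subseteq> z \<and> z \<subseteq> V}" "V \<in> C" "x \<in> C"
    "card C + depth x = Suc (depth V)"
    using saturated_chain[OF ambient_flat assms] flatD(2)[OF assms] by blast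
  have "Sup ?S = depth V - depth x"
  proof (rule cSup_eq_maximum)
    have "C \<in> order_complex {y \<in> L. x \<subseteq> y}" using C(1) unfolding mem_order_complex by auto
    moreover have "depth V - depth x = card C - 1" using C(4) by simp
    ultimately show "depth V - depth x \<in> ?S" using C(2,3) by auto
  next
    fix n assume "n \<in> ?S"
    then show "n \<le> depth V - depth x" using chain_length_le[OF _ assms] by fastforce
  qed
  moreover have "depth x \<le> depth V"
    using depth_less[OF ambient_flat assms] flatD(2)[OF assms] by (cases "x = V") (auto simp: psubset_eq)
  ultimately show ?thesis unfolding rk_def by simp
qed

text \<open>Minimal flats have depth 0, hence all have the same rank, whichever of them is chosen.\<close>
lemma arr_rank_eq_depth: "arr_rank V A = depth V"
proof -
  define m where "m = (SOME x. x \<in> L \<and> (\<forall>y \<in> L. \<not> y \<subset> x))"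
  have "\<exists>x. minimal_flat x" using minimal_flat_below[OF ambient_flat] by blast
  then have "minimal_flat m"
    unfolding m_def minimal_flat_iff by (rule someI_ex)
  then show ?thesis
    using rk_plus_depth[of m] minimal_flat_depth[of m]
    unfolding arr_rank_def m_def[symmetric] minimal_flat_def by simp
qed

end


section \<open>Nonnegativity of the h-polynomial\<close>

definition coeffs_nonneg :: "rat poly \<Rightarrow> bool" where
  "coeffs_nonneg p \<longleftrightarrow> (\<forall>i. 0 \<le> coeff p i)"

lemma coeffs_nonneg_add: "\<lbrakk>coeffs_nonneg p; coeffs_nonneg q\<rbrakk> \<Longrightarrow> coeffs_nonneg (p + q)"
  by (simp add: coeffs_nonneg_def)

lemma coeffs_nonneg_pCons_0: "coeffs_nonneg p \<Longrightarrow> coeffs_nonneg (pCons 0 p)"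
  by (simp add: coeffs_nonneg_def coeff_pCons split: nat.split)

lemma coeffs_nonneg_0: "coeffs_nonneg 0"
  by (simp add: coeffs_nonneg_def)

lemma coeffs_nonneg_trans:
  "\<lbrakk>coeffs_nonneg (q - p); coeffs_nonneg (s - q)\<rbrakk> \<Longrightarrow> coeffs_nonneg (s - p)"
  using coeffs_nonneg_add[of "q - p" "s - q"] by simp

text \<open>For \<open>k \<le> r\<close> the polynomial \<open>(T / (1 - T)) ^ k * (1 - T) ^ r\<close>; hence \<open>h_sum r \<Delta>\<close> is the h-polynomial of a simplicial
  complex \<open>\<Delta>\<close> with at most \<open>r\<close> vertices in each face.\<close>
definition face_weight :: "nat \<Rightarrow> nat \<Rightarrow> rat poly" where
  "face_weight r k = [:0, 1:] ^ k * [:1, -1:] ^ (r - k)"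

definition h_sum :: "nat \<Rightarrow> 'a set set \<Rightarrow> rat poly" where
  "h_sum r S = (\<Sum>F \<in> S. face_weight r (card F))"

lemma face_weight_Suc_Suc: "face_weight (Suc r) (Suc k) = [:0, 1:] * face_weight r k"
  by (simp add: face_weight_def mult_ac)

lemma face_weight_Suc: "k \<le> r \<Longrightarrow> face_weight (Suc r) k = [:1, -1:] * face_weight r k"
  by (simp only: face_weight_def Suc_diff_le power_Suc mult.left_commute)

context affine_arrangement
begin

text \<open>If all members of \<open>E\<close> cross \<open>x\<close>, this is the union of the closed stars of the vertices \<open>x \<inter> H\<close> with
  \<open>H \<in> E\<close> in the order complex: the flags that extend to a flag with such a cover of \<open>x\<close> as its largest set.\<close>
definition flags_within :: "'v set \<Rightarrow> 'v set set \<Rightarrow> 'v set set set" where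
  "flags_within x E = {F \<in> flags x. \<exists>H \<in> E. \<Union>F \<subseteq> H}"

definition h_poly :: "'v set \<Rightarrow> rat poly" where
  "h_poly x = h_sum (depth x) (flags x)"

definition h_within :: "'v set \<Rightarrow> 'v set set \<Rightarrow> rat poly" where
  "h_within x E = h_sum (depth x) (flags_within x E)"

lemma flag_Union_subset: "F \<in> flags x \<Longrightarrow> \<Union>F \<subseteq> x"
  by (auto simp: mem_order_complex below_def)

text \<open>
  A new flag lies in \<open>a = x \<inter> H\<close> but in no member of \<open>E\<close>. It may contain \<open>a\<close>, and then the rest is an
  arbitrary flag below \<open>a\<close>, since \<open>a\<close> itself lies in no member of \<open>E\<close>; or it is a flag below \<open>a\<close> that is not
  captured by \<open>E\<close>.
\<close>
lemma flags_within_insert: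
  assumes x: "x \<in> L" and H: "H \<in> A" "crosses H x" and new: "\<And>e. e \<in> E \<Longrightarrow> \<not> x \<inter> H \<subseteq> e"
  shows "flags_within x (insert H E) = flags_within x E \<union>
    (insert (x \<inter> H) ` flags (x \<inter> H) \<union> (flags (x \<inter> H) - flags_within (x \<inter> H) E))"
    (is "?l = ?r")
proof (rule Set.set_eqI)
  fix F
  note a = crosses_flat[OF x H]
  have incl: "flags (x \<inter> H) \<subseteq> flags x"
    by (intro order_complex_mono psubset_imp_subset below_mono x a)
  show "F \<in> ?l \<longleftrightarrow> F \<in> ?r"
  proof
    assume F: "F \<in> ?l"
    show "F \<in> ?r"
    proof (cases "F \<in> flags_within x E")
      case False
      with F have F: "F \<in> flags x" "\<Union>F \<subseteq> H" "\<forall>e \<in> E. \<not> \<Union>F \<subseteq> e"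
        unfolding flags_within_def by auto
      then have sub: "y \<in> L" "y \<subseteq> x \<inter> H" if "y \<in> F" for y
        using that by (auto simp: mem_order_complex below_def)
      have rest: "F - {x \<inter> H} \<in> flags (x \<inter> H)"
        using F(1) sub by (auto simp: mem_order_complex below_def)
      show ?thesis
      proof (cases "x \<inter> H \<in> F")
        case True
        then have "F = insert (x \<inter> H) (F - {x \<inter> H})" by auto
        then show ?thesis using rest by blast
      next
        case False
        then show ?thesis using rest F(3) by (simp add: flags_within_def)
      qed
    qed simp
  next
    assume "F \<in> ?r"
    then consider "F \<in> flags_within x E"
      | G where "G \<in> flags (x \<inter> H)" "F = insert (x \<inter> H) G"
      | "F \<in> flags (x \<inter> H)" by blast
    then show "F \<in> ?l"
    proof cases
      case 1
      then show ?thesis by (auto simp: flags_within_def)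
    next
      case 2
      then show ?thesis using insert_flag(1)[OF x a 2(1)] flag_Union_subset[OF 2(1)]
        by (auto simp: flags_within_def)
    next
      case 3
      then show ?thesis using incl flag_Union_subset[OF 3] by (auto simp: flags_within_def)
    qed
  qed
qed

text \<open>
  With \<open>h\<close> and \<open>k\<close> the polynomials of all flags below \<open>a = x \<inter> H\<close> and of those captured by \<open>E\<close>, the two
  kinds of new flags contribute \<open>T * h\<close> and \<open>(1 - T) * (h - k)\<close>. The sum is \<open>(h - k) + T * k\<close>, so it is
  nonnegative as soon as \<open>0 \<le> k \<le> h\<close> holds coefficientwise; this is what makes the induction close up.
\<close>
lemma h_within_insert:
  assumes x: "x \<in> L" and H: "H \<in> A" "crosses H x" and new: "\<And>e. e \<in> E \<Longrightarrow> \<not> x \<inter> H \<subseteq> e"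
  shows "h_within x (insert H E) - h_within x E =
    (h_poly (x \<inter> H) - h_within (x \<inter> H) E) + pCons 0 (h_within (x \<inter> H) E)"
proof -
  let ?a = "x \<inter> H"
  note a = crosses_flat[OF x H]
  have d: "depth x = Suc (depth ?a)" by (rule depth_Int_hyperplane[OF x H])
  have notin: "?a \<notin> G" "finite G" if "G \<in> flags ?a" for G
    using that by (auto simp: mem_order_complex below_def)
  let ?I = "insert ?a ` flags ?a" and ?D = "flags ?a - flags_within ?a E"
  have fin: "finite (flags_within y E)" for y
    unfolding flags_within_def using finite_flags by simp
  have "\<not> \<Union>F \<subseteq> e" if "F \<in> ?I" "e \<in> E" for F e using that new by blast
  moreover have "F \<notin> flags_within x E" if "F \<in> ?D" for F
    using that unfolding flags_within_def by blast
  ultimately have disj: "flags_within x E \<inter> (?I \<union> ?D) = {}" unfolding flags_within_def by blast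
  have disj': "?I \<inter> ?D = {}" using notin by blast
  have inj: "inj_on (insert ?a) (flags ?a)" using notin(1) by (meson inj_onI insert_ident)
  have "h_sum (depth x) ?I = (\<Sum>G \<in> flags ?a. face_weight (Suc (depth ?a)) (Suc (card G)))"
    unfolding h_sum_def d using notin by (subst sum.reindex[OF inj]) (auto intro!: sum.cong)
  then have sI: "h_sum (depth x) ?I = [:0, 1:] * h_poly ?a"
    unfolding h_poly_def h_sum_def by (simp only: face_weight_Suc_Suc sum_distrib_left)
  have "h_sum (depth x) ?D = [:1, -1:] * h_sum (depth ?a) ?D"
    unfolding h_sum_def d sum_distrib_left
    by (intro sum.cong refl face_weight_Suc card_flag_le_depth) simp
  moreover have "h_sum (depth ?a) ?D = h_poly ?a - h_within ?a E"
    unfolding h_sum_def h_poly_def h_within_def using finite_flags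
    by (intro sum_diff) (auto simp: flags_within_def)
  ultimately have sD: "h_sum (depth x) ?D = [:1, -1:] * (h_poly ?a - h_within ?a E)" by simp
  have "h_within x (insert H E) = h_within x E + (h_sum (depth x) ?I + h_sum (depth x) ?D)"
  proof -
    have "flags_within x (insert H E) = flags_within x E \<union> (?I \<union> ?D)"
      by (rule flags_within_insert[OF x H new])
    then have "h_within x (insert H E) = h_sum (depth x) (flags_within x E \<union> (?I \<union> ?D))"
      by (simp only: h_within_def)
    also have "\<dots> = h_within x E + h_sum (depth x) (?I \<union> ?D)"
      unfolding h_within_def h_sum_def using fin finite_flags
      by (intro sum.union_disjoint disj) auto
    also have "h_sum (depth x) (?I \<union> ?D) = h_sum (depth x) ?I + h_sum (depth x) ?D"
      unfolding h_sum_def using finite_flags by (intro sum.union_disjoint disj') auto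
    finally show ?thesis .
  qed
  moreover define X :: "rat poly" where "X = [:0, 1:]"
  then have "[:1, -1:] = 1 - X" "pCons 0 (h_within ?a E) = X * h_within ?a E"
    by (simp_all add: one_pCons)
  ultimately show ?thesis unfolding sI sD by (simp add: X_def[symmetric] algebra_simps)
qed

text \<open>
  The sets of hyperplanes that occur when the hyperplanes crossing \<open>x\<close> are added one at a time, first
  those through a minimal flat \<open>m\<close> and then the others. The second alternative records only that some
  members of \<open>E\<close> cut out a minimal flat. In this form the first alternative passes to \<open>x \<inter> H\<close> for every \<open>H \<supseteq> m\<close>, and
  the second for every \<open>H\<close> that crosses \<open>x\<close>. For arbitrary \<open>E\<close> the bounds in \<open>h_within_bounds\<close> fail: if \<open>x\<close>
  has positive depth and the members of a nonempty \<open>E\<close> are all parallel to \<open>x\<close>, only the empty flag is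
  captured, and its weight \<open>(1 - T) ^ depth x\<close> has a negative coefficient.
\<close>
definition initial_segment :: "'v set \<Rightarrow> 'v set set \<Rightarrow> bool" where
  "initial_segment x E \<longleftrightarrow> (\<exists>m. minimal_flat m \<and> m \<subseteq> x \<and>
     ((\<forall>H \<in> E. m \<subseteq> H) \<or> (\<exists>B \<subseteq> E. x \<inter> \<Inter>B = m)))"

text \<open>
  Choose \<open>B' \<subseteq> B\<close> maximal such that \<open>y = a \<inter> \<Inter>B'\<close> is nonempty. Then no member of \<open>B\<close> crosses \<open>y\<close>, so
  a hyperplane crossing \<open>y\<close> would by parallelism cross the minimal flat \<open>x \<inter> \<Inter>B\<close>.
\<close>
lemma minimal_flat_in_hyperplane:
  assumes x: "x \<in> L" and B: "B \<subseteq> A" "minimal_flat (x \<inter> \<Inter>B)" and a: "a \<in> L" "a \<subseteq> x"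
  obtains B' where "B' \<subseteq> B" "minimal_flat (a \<inter> \<Inter>B')"
proof -
  let ?S = "{B' \<in> Pow B. a \<inter> \<Inter>B' \<noteq> {}}"
  have fin: "finite ?S" using finite_subset[OF B(1) finite_hyperplanes] by simp
  have mem: "{} \<in> ?S" using flatD(1)[OF a(1)] by simp
  obtain B' where B': "B' \<in> ?S" and max: "\<forall>C \<in> ?S. B' \<subseteq> C \<longrightarrow> B' = C"
    using finite_has_maximal2[OF fin mem] by (elim bexE conjE)
  let ?y = "a \<inter> \<Inter>B'"
  have y: "?y \<in> L" using B' B(1) by (intro flat_Inter a) auto
  have "\<not> crosses b ?y" if b: "b \<in> B" for b
  proof
    assume cr: "crosses b ?y"
    then have "insert b B' \<in> ?S" using b B' unfolding crosses_def by auto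
    then have "B' = insert b B'" by (rule max[rule_format]) blast
    then show False using cr unfolding crosses_def by blast
  qed
  moreover have "x \<inter> \<Inter>B \<noteq> {}" using B(2) flatD(1) unfolding minimal_flat_def by blast
  ultimately have "\<not> crosses G ?y" if "G \<in> A" for G
    using parallel[OF x y _ B(1)] a(2) B(2) that unfolding minimal_flat_def by blast
  then show ?thesis using that[of B'] B' y unfolding minimal_flat_def by blast
qed

text \<open>
  If \<open>H\<close> is parallel to \<open>x\<close>, or if its trace on \<open>x\<close> is contained in a member of \<open>E\<close>, no flag is added:
  in the parallel case it could only be the empty flag, which every nonempty \<open>E\<close> captures already.
\<close>
lemma h_within_mono_step:
  assumes x: "x \<in> L" and H: "H \<in> A" "\<not> x \<subseteq> H" and ne: "E \<noteq> {} \<or> crosses H x"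
    and a: "crosses H x \<Longrightarrow> coeffs_nonneg (h_within (x \<inter> H) E) \<and>
      coeffs_nonneg (h_poly (x \<inter> H) - h_within (x \<inter> H) E)"
  shows "coeffs_nonneg (h_within x (insert H E) - h_within x E)"
proof (cases "crosses H x \<and> (\<forall>e \<in> E. \<not> x \<inter> H \<subseteq> e)")
  case True
  then show ?thesis
    using h_within_insert[OF x H(1)] a by (simp add: coeffs_nonneg_add coeffs_nonneg_pCons_0)
next
  case False
  have "\<exists>e \<in> E. \<Union>F \<subseteq> e" if F: "F \<in> flags x" "\<Union>F \<subseteq> H" for F
  proof (cases "crosses H x")
    case True
    then obtain e where "e \<in> E" "x \<inter> H \<subseteq> e" using False by blast
    then show ?thesis using F(2) flag_Union_subset[OF F(1)] by blast
  next
    case nc: False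
    then have "x \<inter> H = {}" using H(2) by (simp add: crosses_def)
    then have "\<Union>F = {}" using F(2) flag_Union_subset[OF F(1)] by blast
    then show ?thesis using ne nc by auto
  qed
  then have "flags_within x (insert H E) = flags_within x E" unfolding flags_within_def by blast
  then show ?thesis by (simp add: h_within_def coeffs_nonneg_0)
qed

lemma h_within_mono:
  assumes "finite D"
    and "\<And>E' H. \<lbrakk>E \<subseteq> E'; E' \<subseteq> E \<union> D; H \<in> D\<rbrakk>
      \<Longrightarrow> coeffs_nonneg (h_within x (insert H E') - h_within x E')"
  shows "coeffs_nonneg (h_within x (E \<union> D) - h_within x E)"
  using assms
proof (induction D rule: finite_induct)
  case empty
  then show ?case by (simp add: coeffs_nonneg_0)
next
  case (insert H D)
  have "coeffs_nonneg (h_within x (E \<union> D) - h_within x E)"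
    by (rule insert.IH) (rule insert.prems; blast)
  moreover have "coeffs_nonneg (h_within x (insert H (E \<union> D)) - h_within x (E \<union> D))"
    by (rule insert.prems) auto
  ultimately have "coeffs_nonneg (h_within x (insert H (E \<union> D)) - h_within x E)"
    by (rule coeffs_nonneg_trans)
  then show ?case by (simp only: Un_insert_right)
qed

lemma h_within_empty: "h_within x {} = 0"
  by (simp add: h_within_def flags_within_def h_sum_def)

text \<open>
  Unless \<open>x\<close> is minimal, grow the empty set first by hyperplanes through a minimal flat \<open>m\<close> and then to the
  set \<open>N\<close> of all hyperplanes that do not contain \<open>x\<close>; every step is nonnegative by induction. The polynomial grows
  from \<open>0\<close> to the full h-polynomial, and the order of the hyperplanes can be chosen such that \<open>E\<close> is reached on the
  way. If a member of \<open>E\<close> contains \<open>x\<close>, then \<open>E\<close> captures all flags.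
\<close>
lemma h_within_bounds:
  assumes "x \<in> L" "E \<subseteq> A" "initial_segment x E"
  shows "coeffs_nonneg (h_within x E) \<and> coeffs_nonneg (h_poly x - h_within x E)"
  using assms
proof (induction x arbitrary: E rule: flat_induct)
  case (flat x)
  show ?case
  proof (cases "minimal_flat x")
    case True
    then have "below L x = {}" unfolding minimal_flat_iff below_def by blast
    then have flags: "flags x = {{}}" by (auto simp: mem_order_complex)
    then have "flags_within x E = (if E = {} then {} else {{}})"
      by (auto simp: flags_within_def)
    then show ?thesis
      using minimal_flat_depth[OF True] flags
      by (auto simp: h_poly_def h_within_def h_sum_def face_weight_def coeffs_nonneg_def)
  next
    case nonmin: False
    define N where "N = {H \<in> A. \<not> x \<subseteq> H}"
    have fin: "finite N" "\<And>D. D \<subseteq> N \<Longrightarrow> finite D"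
      unfolding N_def using finite_hyperplanes by (auto intro: finite_subset)
    have "\<exists>H \<in> N. \<Union>F \<subseteq> H" if F: "F \<in> flags x" for F
    proof (cases "F = {}")
      case True
      obtain H where "H \<in> A" "crosses H x" using nonmin flat.hyps unfolding minimal_flat_def by blast
      then show ?thesis using True by (auto simp: N_def crosses_def)
    next
      case False
      then obtain H where "H \<in> A" "crosses H x" "\<Union>F \<subseteq> H"
        using crossing_hyperplane_above[OF flat.hyps Union_flag_flat[OF F]] by blast
      then show ?thesis by (auto simp: N_def crosses_def)
    qed
    then have "flags_within x N = flags x" unfolding flags_within_def by blast
    then have hN: "h_within x N = h_poly x" by (simp add: h_within_def h_poly_def)
    \<comment> \<open>Adding hyperplanes through \<open>m\<close>: all of them cross \<open>x\<close>, and \<open>m\<close> is also a minimal flat of \<open>x \<inter> H\<close>.\<close>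
    have phase1: "coeffs_nonneg (h_within x (E' \<union> D) - h_within x E')"
      if m: "minimal_flat m" "m \<subseteq> x" and D: "E' \<union> D \<subseteq> {H \<in> N. m \<subseteq> H}" for E' D m
    proof (rule h_within_mono)
      fix E'' H assume E'': "E' \<subseteq> E''" "E'' \<subseteq> E' \<union> D" and H: "H \<in> D"
      have mL: "m \<noteq> {}" using m(1) flatD(1) unfolding minimal_flat_def by blast
      have HN: "H \<in> A" "\<not> x \<subseteq> H" "m \<subseteq> H" using H D by (auto simp: N_def)
      then have cr: "crosses H x" using m(2) mL unfolding crosses_def by blast
      have "\<forall>H \<in> E''. m \<subseteq> H" using E''(2) D by blast
      then have "initial_segment (x \<inter> H) E''"
        using m HN(3) unfolding initial_segment_def by (intro exI[of _ m]) simp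
      moreover have "E'' \<subseteq> A" using E'' D by (auto simp: N_def)
      ultimately show "coeffs_nonneg (h_within x (insert H E'') - h_within x E'')"
        using flat.IH[OF crosses_flat[OF flat.hyps HN(1) cr]] cr
        by (intro h_within_mono_step[OF flat.hyps HN(1,2)]) auto
    next
      show "finite D" using D fin(2)[of D] by blast
    qed
    \<comment> \<open>Adding arbitrary hyperplanes once a subset \<open>B\<close> cuts out a minimal flat.\<close>
    have phase2: "coeffs_nonneg (h_within x D - h_within x E')"
      if B: "minimal_flat (x \<inter> \<Inter>B)" "B \<subseteq> E'" and E': "E' \<subseteq> D" "D \<subseteq> N" for B D E'
    proof -
      have "coeffs_nonneg (h_within x (E' \<union> D) - h_within x E')"
      proof (rule h_within_mono[OF fin(2)[OF E'(2)]])
        fix E'' H assume E'': "E' \<subseteq> E''" "E'' \<subseteq> E' \<union> D" and "H \<in> D"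
        then have H: "H \<in> N" using E'(2) by blast
        have HA: "H \<in> A" "\<not> x \<subseteq> H" using H by (auto simp: N_def)
        have "B \<noteq> {}" using B(1) nonmin by auto
        then have ne: "E'' \<noteq> {}" using B(2) E'' by blast
        have EA: "E'' \<subseteq> A" using E'' E' by (auto simp: N_def)
        then have BA: "B \<subseteq> A" using B(2) E''(1) by blast
        have "coeffs_nonneg (h_within (x \<inter> H) E'') \<and>
          coeffs_nonneg (h_poly (x \<inter> H) - h_within (x \<inter> H) E'')" if cr: "crosses H x"
        proof -
          note a = crosses_flat[OF flat.hyps HA(1) cr]
          obtain B' where "B' \<subseteq> B" "minimal_flat (x \<inter> H \<inter> \<Inter>B')"
            using minimal_flat_in_hyperplane[OF flat.hyps BA B(1) a(1)] by blast
          moreover have "B \<subseteq> E''" using B(2) E''(1) by blast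
          ultimately have "initial_segment (x \<inter> H) E''" unfolding initial_segment_def by (metis inf_le1 order_trans)
          then show ?thesis using flat.IH[OF a EA] by blast
        qed
        then show "coeffs_nonneg (h_within x (insert H E'') - h_within x E'')"
          using ne by (intro h_within_mono_step[OF flat.hyps HA]) auto
      qed
      moreover have "E' \<union> D = D" using E' by blast
      ultimately show ?thesis by simp
    qed
    \<comment> \<open>The end of the first phase is a starting point of the second.\<close>
    have span: "x \<inter> \<Inter>{H \<in> N. m \<subseteq> H} = m" if m: "minimal_flat m" "m \<subseteq> x" for m
    proof -
      obtain C where C: "C \<subseteq> A" "m = V \<inter> \<Inter>C"
        using m(1) unfolding minimal_flat_def flats_def by auto
      have "x \<inter> \<Inter>{H \<in> N. m \<subseteq> H} \<subseteq> H" if "H \<in> C" for H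
      proof (cases "x \<subseteq> H")
        case False
        then have "H \<in> {H \<in> N. m \<subseteq> H}" using that C by (auto simp: N_def)
        then show ?thesis by blast
      qed blast
      then show ?thesis using m(2) C(2) flatD(2)[OF flat.hyps] by blast
    qed
    have full: "coeffs_nonneg (h_poly x - h_within x E') \<and> coeffs_nonneg (h_within x E')"
      if m: "minimal_flat m" "m \<subseteq> x" and E': "E' \<subseteq> {H \<in> N. m \<subseteq> H}" for m E'
    proof -
      have "E' \<union> {H \<in> N. m \<subseteq> H} = {H \<in> N. m \<subseteq> H}" using E' by blast
      then have "coeffs_nonneg (h_within x {H \<in> N. m \<subseteq> H} - h_within x E')"
        using phase1[OF m, of E' "{H \<in> N. m \<subseteq> H}"] by simp
      moreover have "coeffs_nonneg (h_within x N - h_within x {H \<in> N. m \<subseteq> H})"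
        using span[OF m] m by (intro phase2[of "{H \<in> N. m \<subseteq> H}"]) auto
      moreover have "coeffs_nonneg (h_within x E')"
        using phase1[OF m, of "{}" E'] E' by (simp add: h_within_empty)
      ultimately show ?thesis using coeffs_nonneg_trans hN by metis
    qed
    obtain m where m: "minimal_flat m" "m \<subseteq> x" and seg: "(\<forall>H \<in> E. m \<subseteq> H) \<or> (\<exists>B \<subseteq> E. x \<inter> \<Inter>B = m)"
      using flat.prems(2) unfolding initial_segment_def by blast
    show ?thesis
    proof (cases "\<exists>H \<in> E. x \<subseteq> H")
      case True
      then have "flags_within x E = flags x"
        using flag_Union_subset unfolding flags_within_def by blast
      then have "h_within x E = h_poly x" by (simp add: h_within_def h_poly_def)
      moreover have "coeffs_nonneg (h_poly x)" using full[OF m, of "{}"] by (simp add: h_within_empty)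
      ultimately show ?thesis by (simp add: coeffs_nonneg_0)
    next
      case False
      then have EN: "E \<subseteq> N" using flat.prems(1) by (auto simp: N_def)
      from seg show ?thesis
      proof
        assume "\<forall>H \<in> E. m \<subseteq> H"
        then show ?thesis using full[OF m, of E] EN by blast
      next
        assume "\<exists>B \<subseteq> E. x \<inter> \<Inter>B = m"
        then obtain B where B: "B \<subseteq> E" "x \<inter> \<Inter>B = m" by blast
        have minB: "minimal_flat (x \<inter> \<Inter>B)" using m(1) B(2) by simp
        have "coeffs_nonneg (h_within x B)" using full[OF m, of B] B EN by blast
        moreover have "coeffs_nonneg (h_within x E - h_within x B)"
          using phase2[OF minB order_refl B(1) EN] .
        moreover have "coeffs_nonneg (h_within x N - h_within x E)"
          using phase2[OF minB B(1) EN order_refl] .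
        ultimately show ?thesis
          using coeffs_nonneg_add[of "h_within x B" "h_within x E - h_within x B"] hN by simp
      qed
    qed
  qed
qed

end


section \<open>Signs of the Moebius function\<close>

context affine_arrangement
begin

lemma h_poly_nonneg: "x \<in> L \<Longrightarrow> coeffs_nonneg (h_poly x)"
proof -
  assume x: "x \<in> L"
  obtain m where "minimal_flat m" "m \<subseteq> x" by (rule minimal_flat_below[OF x])
  then have "initial_segment x {}" unfolding initial_segment_def by blast
  then show ?thesis using h_within_bounds[OF x, of "{}"] by (simp add: h_within_empty)
qed

abbreviation mu :: "'v set \<Rightarrow> int" where
  "mu x \<equiv> mobius L V x"

lemma mu_ambient: "mu V = 1"
  using finite_flats by (simp add: mobius.simps)

lemma mu_sum:
  assumes "y \<in> L" "y \<noteq> V"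
  shows "(\<Sum>z \<in> {z \<in> L. y \<subseteq> z}. mu z) = 0"
proof -
  have yV: "y \<subset> V" using assms flatD(2) by blast
  have "mu y = - (\<Sum>z \<in> {z \<in> L. y \<subset> z \<and> z \<subseteq> V}. mu z)"
    using finite_flats yV by (subst mobius.simps) auto
  moreover have "{z \<in> L. y \<subseteq> z} = insert y {z \<in> L. y \<subset> z \<and> z \<subseteq> V}"
    using assms(1) flatD(2) by auto
  ultimately show ?thesis using finite_flats by simp
qed

text \<open>
  Summing the asserted identity over all flats \<open>w\<close> with \<open>y \<subseteq> w \<subseteq> H\<close> gives the sum of \<open>mu z\<close> over all flats
  \<open>z \<supseteq> y\<close>, since \<open>y \<subseteq> z \<inter> H\<close> holds iff \<open>y \<subseteq> z\<close>. That sum vanishes, and so do all summands with \<open>w \<noteq> y\<close>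
  by induction.
\<close>
lemma weisner:
  assumes H: "H \<in> A" and y: "y \<in> L" "y \<subseteq> H"
  shows "(\<Sum>z \<in> {z \<in> L. z \<inter> H = y}. mu z) = 0"
  using y
proof (induction "card {w \<in> L. y \<subset> w}" arbitrary: y rule: less_induct)
  case less
  let ?T = "{w \<in> L. y \<subseteq> w \<and> w \<subseteq> H}"
  let ?f = "\<lambda>w. \<Sum>z \<in> {z \<in> L. z \<inter> H = w}. mu z"
  have zero: "?f w = 0" if "w \<in> ?T - {y}" for w
  proof (rule less.hyps)
    have "{v \<in> L. w \<subset> v} \<subset> {v \<in> L. y \<subset> v}" using that by auto
    then show "card {v \<in> L. w \<subset> v} < card {v \<in> L. y \<subset> v}"
      using finite_flats by (simp add: psubset_card_mono)
  qed (use that in auto)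
  have "(\<Sum>w \<in> ?T. \<Sum>z \<in> {z \<in> {z \<in> L. y \<subseteq> z}. z \<inter> H = w}. mu z) = (\<Sum>z \<in> {z \<in> L. y \<subseteq> z}. mu z)"
  proof (rule sum.group)
    show "(\<lambda>z. z \<inter> H) ` {z \<in> L. y \<subseteq> z} \<subseteq> ?T"
    proof (rule image_subsetI)
      fix z assume "z \<in> {z \<in> L. y \<subseteq> z}"
      then show "z \<inter> H \<in> ?T"
        using less.prems flatD(1)[OF less.prems(1)] flat_Int[of z H] H by auto
    qed
  qed (use finite_flats in auto)
  also have "\<dots> = 0"
    using less.prems hyperplane_proper[OF H] by (intro mu_sum) auto
  also have "(\<Sum>w \<in> ?T. \<Sum>z \<in> {z \<in> {z \<in> L. y \<subseteq> z}. z \<inter> H = w}. mu z) = (\<Sum>w \<in> ?T. ?f w)"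
    by (intro sum.cong refl) auto
  also have "\<dots> = ?f y + (\<Sum>w \<in> ?T - {y}. ?f w)"
    using finite_flats less.prems by (intro sum.remove) auto
  also have "(\<Sum>w \<in> ?T - {y}. ?f w) = 0" using zero by (intro sum.neutral) blast
  finally show ?case by simp
qed

text \<open>
  Weisner's identity for a hyperplane \<open>H \<supseteq> y\<close> expresses \<open>mu y\<close> as minus the sum of \<open>mu z\<close> over the flats
  \<open>z \<noteq> y\<close> with \<open>z \<inter> H = y\<close>; all of these have rank one less than \<open>y\<close>.
\<close>
lemma mu_sign:
  assumes "y \<in> L"
  shows "0 \<le> (- 1) ^ rk V A y * mu y"
  using assms
proof (induction "rk V A y" arbitrary: y rule: less_induct)
  case less
  show ?case
  proof (cases "y = V")
    case True
    then show ?thesis using rk_plus_depth[OF ambient_flat] by (simp add: mu_ambient)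
  next
    case False
    then have "y \<subset> V" using flatD(2) less.prems by blast
    then obtain H where H: "H \<in> A" "y \<subseteq> H"
      using crossing_hyperplane_above[OF ambient_flat less.prems] by blast
    let ?Z = "{z \<in> L. z \<inter> H = y} - {y}"
    have rk: "rk V A y = Suc (rk V A z)" "z \<in> L" if z: "z \<in> ?Z" for z
    proof -
      show zL: "z \<in> L" using z by blast
      have "crosses H z" using z flatD(1)[OF less.prems] unfolding crosses_def by auto
      then have "depth z = Suc (depth y)" using depth_Int_hyperplane[OF zL H(1)] z by auto
      then show "rk V A y = Suc (rk V A z)"
        using rk_plus_depth[OF zL] rk_plus_depth[OF less.prems] by simp
    qed
    have "0 = mu y + (\<Sum>z \<in> ?Z. mu z)"
      using weisner[OF H(1) less.prems H(2)] finite_flats less.prems H(2)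
      by (subst (asm) sum.remove[of _ y]) auto
    then have mu: "mu y = - (\<Sum>z \<in> ?Z. mu z)" by simp
    have "(- 1) ^ rk V A y * mu y = (\<Sum>z \<in> ?Z. - ((- 1) ^ rk V A y * mu z))"
      unfolding mu by (simp add: sum_negf sum_distrib_left)
    also have "\<dots> = (\<Sum>z \<in> ?Z. (- 1) ^ rk V A z * mu z)"
    proof (rule sum.cong)
      fix z assume "z \<in> ?Z"
      then show "- ((- 1) ^ rk V A y * mu z) = (- 1) ^ rk V A z * mu z"
        by (simp only: rk(1)[of z]) simp
    qed simp
    also have "\<dots> \<ge> 0"
    proof (rule sum_nonneg)
      fix z assume z: "z \<in> ?Z"
      then have "rk V A z < rk V A y" by (simp only: rk(1)[of z])
      then show "0 \<le> (- 1) ^ rk V A z * mu z" using less.hyps rk(2)[OF z] by blast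
    qed
    finally show ?thesis .
  qed
qed

lemma poincare_nonneg: "coeffs_nonneg (poincare V A)"
proof -
  have "[:0, - 1 :: rat:] ^ n = monom ((- 1) ^ n) n" for n
    by (induction n) (simp_all add: monom_0 monom_Suc minus_monom)
  moreover have "(of_int c :: rat poly) * p = smult (of_int c) p" for c p
    by (simp add: of_int_poly)
  ultimately have "poincare V A = (\<Sum>x \<in> L. monom (of_int ((- 1) ^ rk V A x * mu x)) (rk V A x))"
    unfolding poincare_def by (simp add: smult_monom mult.commute[of "(- 1) ^ _"])
  then show ?thesis using mu_sign
    by (auto simp: coeffs_nonneg_def coeff_sum simp del: of_int_mult intro!: sum_nonneg)
qed

lemma poincare_restriction_ambient: "poincare V (restriction (localization A {}) V) = poincare V A"
proof -
  have "localization A {} = A" by (simp add: localization_def)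
  moreover have "V \<inter> H = H" "H \<noteq> {}" "\<not> V \<subseteq> H" if "H \<in> A" for H
    using hyperplane_proper[OF that] by auto
  then have "restriction A V = A" unfolding restriction_def localization_def by fastforce
  ultimately show ?thesis by simp
qed

end

text \<open>Only the ambient space \<open>x\<close> has rank 0.\<close>
lemma coeff_0_poincare:
  assumes "finite B" "x \<noteq> {}"
  shows "coeff (poincare x B) 0 = 1"
proof -
  have fin: "finite (flats x B)"
  proof -
    have "flats x B \<subseteq> (\<lambda>C. x \<inter> \<Inter>C) ` Pow B" unfolding flats_def by auto
    then show ?thesis using assms(1) by (meson finite_Pow_iff finite_imageI finite_subset)
  qed
  have xL: "x \<in> flats x B" using assms(2) unfolding flats_def by (auto intro!: exI[of _ "{}"])
  have sub: "y \<subseteq> x" if "y \<in> flats x B" for y using that unfolding flats_def by auto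
  have pos: "rk x B y > 0" if y: "y \<in> flats x B" "y \<noteq> x" for y
  proof -
    let ?P = "order_complex {z \<in> flats x B. y \<subseteq> z}"
    let ?S = "{card C - 1 | C. C \<in> ?P \<and> x \<in> C \<and> y \<in> C}"
    have "finite ?P" using fin by (intro finite_order_complex) simp
    then have "finite ?S" by simp
    moreover have "{x, y} \<in> ?P" using y xL sub by (auto simp: mem_order_complex)
    then have "card {x, y} - 1 \<in> ?S" by blast
    ultimately have "card {x, y} - 1 \<le> rk x B y"
      unfolding rk_def by (intro cSup_upper) (auto simp: bdd_above_nat)
    then show ?thesis using y(2) by simp
  qed
  have zero: "rk x B x = 0"
  proof -
    have "{z \<in> flats x B. x \<subseteq> z} = {x}" using xL sub by auto
    then have "{card C - 1 | C. C \<in> order_complex {z \<in> flats x B. x \<subseteq> z} \<and> x \<in> C \<and> x \<in> C} = {0}"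
      by (auto simp: mem_order_complex subset_singleton_iff intro!: exI[of _ "{x}"])
    then show ?thesis unfolding rk_def by simp
  qed
  have "coeff (of_int m * [:0, - 1 :: rat:] ^ n) 0 = (if n = 0 then of_int m else 0)" for m n
    by (cases n) (simp_all add: of_int_poly coeff_mult)
  then have "coeff (poincare x B) 0 =
      (\<Sum>y \<in> flats x B. if rk x B y = 0 then of_int (mobius (flats x B) x y) else 0)"
    unfolding poincare_def coeff_sum by simp
  also have "\<dots> = (\<Sum>y \<in> flats x B. if y = x then 1 else 0)"
  proof (rule sum.cong)
    have "mobius (flats x B) x x = 1" using fin by (simp add: mobius.simps)
    then show "(if rk x B y = 0 then of_int (mobius (flats x B) x y) else 0) =
        (if y = x then 1 else (0 :: rat))" if "y \<in> flats x B" for y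
      using pos[OF that] zero by (cases "y = x") simp_all
  qed simp
  finally show ?thesis using fin xL by simp
qed


section \<open>The numerator polynomial\<close>

lemma sorted_wrt_supset_unique:
  assumes "sorted_wrt (\<supset>) xs" "sorted_wrt (\<supset>) ys" "set xs = set ys"
  shows "xs = ys"
  using assms
proof (induction xs arbitrary: ys)
  case (Cons x xs)
  then obtain y zs where ys: "ys = y # zs" by (cases ys) auto
  have dec: "\<And>z. z \<in> set xs \<Longrightarrow> z \<subset> x" "\<And>z. z \<in> set zs \<Longrightarrow> z \<subset> y"
    using Cons.prems ys by auto
  have "x = y"
  proof (rule ccontr)
    assume "x \<noteq> y"
    then have "x \<in> set zs" "y \<in> set xs" using Cons.prems(3) ys by auto
    then show False using dec by blast
  qed
  moreover have "set xs = set zs"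
    using Cons.prems(3) ys dec \<open>x = y\<close> by (metis list.simps(15) insert_ident psubset_eq)
  ultimately show ?case using Cons.IH[of zs] Cons.prems ys by simp
qed simp

lemma flag_list:
  assumes "F \<in> order_complex P"
  shows "set (flag_list F) = F" "sorted_wrt (\<supset>) (flag_list F)"
proof -
  have "\<exists>xs. set xs = F \<and> sorted_wrt (\<supset>) xs" using assms
  proof (induction "card F" arbitrary: F)
    case 0
    then show ?case by (intro exI[of _ "[]"]) (simp add: mem_order_complex)
  next
    case (Suc n)
    then have "F \<noteq> {}" by auto
    then have fin: "finite F" and top: "\<Union>F \<in> F"
      using Union_flag_mem[OF Suc.prems] Suc.prems by (auto simp: mem_order_complex)
    have "F - {\<Union>F} \<in> order_complex P" using Suc.prems by (auto simp: mem_order_complex)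
    then obtain xs where xs: "set xs = F - {\<Union>F}" "sorted_wrt (\<supset>) xs"
      using Suc fin top by (metis card_Diff_singleton diff_Suc_1)
    have "\<forall>z \<in> set xs. z \<subset> \<Union>F" using xs(1) by auto
    then show ?case using xs top by (intro exI[of _ "\<Union>F # xs"]) auto
  qed
  then have "\<exists>!xs. set xs = F \<and> sorted_wrt (\<supset>) xs" using sorted_wrt_supset_unique by blast
  from theI'[OF this] show "set (flag_list F) = F" "sorted_wrt (\<supset>) (flag_list F)"
    unfolding flag_list_def by auto
qed

lemma length_flag_list:
  assumes "F \<in> order_complex P"
  shows "length (flag_list F) = card F"
proof -
  have "distinct xs" if "sorted_wrt (\<supset>) xs" for xs :: "'a set list"
    using that by (induction xs) auto
  then show ?thesis using flag_list[OF assms] distinct_card by metis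
qed

lemma flag_list_empty: "flag_list {} = []"
  using flag_list(1)[OF empty_flag] by simp

lemma power_geometric_fps:
  assumes "k \<le> r"
  shows "(fps_X / (1 - fps_X)) ^ k = 1 / (1 - fps_X :: rat fps) ^ r * fps_of_poly (face_weight r k)"
proof -
  define u :: "rat fps" where "u = inverse (1 - fps_X)"
  have u: "u * (1 - fps_X) = 1" unfolding u_def by (rule inverse_mult_eq_1) simp
  have weight: "fps_of_poly (face_weight r k) = fps_X ^ k * (1 - fps_X :: rat fps) ^ (r - k)"
    unfolding face_weight_def fps_of_poly_mult fps_of_poly_power
    by (simp add: fps_of_poly_pCons)
  have inv: "1 / (1 - fps_X) ^ r = u ^ r"
    unfolding u_def by (subst fps_divide_unit) (auto simp: fps_inverse_power)
  have split: "u ^ r = u ^ k * u ^ (r - k)" using assms by (simp flip: power_add)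
  have quot: "fps_X / (1 - fps_X) = fps_X * u" unfolding u_def by (rule fps_divide_unit) simp
  have one: "u ^ (r - k) * (1 - fps_X) ^ (r - k) = 1" using u by (simp flip: power_mult_distrib)
  have "(fps_X / (1 - fps_X)) ^ k = fps_X ^ k * u ^ k * (u ^ (r - k) * (1 - fps_X) ^ (r - k))"
    unfolding quot power_mult_distrib one by simp
  also have "\<dots> = u ^ r * (fps_X ^ k * (1 - fps_X) ^ (r - k))"
    unfolding split by (simp only: mult_ac)
  finally show ?thesis unfolding weight inv .
qed

context affine_arrangement
begin

lemma proper_flats_eq_below: "proper_flats V A = below L V"
  using flatD(2) unfolding proper_flats_def below_def by auto

lemma flag_poincare_empty: "flag_poincare V A {} = poincare V A"
  unfolding flag_poincare_def flag_list_empty using poincare_restriction_ambient by simp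

lemma coeff_0_flag_poincare:
  assumes F: "F \<in> flags V"
  shows "coeff (flag_poincare V A F) 0 = 1"
proof -
  let ?xs = "V # flag_list F @ [{}]"
  have "poly (poincare (?xs ! k) (restriction (localization A (?xs ! Suc k)) (?xs ! k))) 0 = 1"
    if "k \<le> card F" for k
  proof -
    have "?xs ! k = (V # flag_list F) ! k"
      using that by (subst append_Cons[symmetric], subst nth_append) (simp add: length_flag_list[OF F])
    moreover have "(V # flag_list F) ! k \<in> set (V # flag_list F)"
      using that by (intro nth_mem) (simp add: length_flag_list[OF F])
    moreover have "set (V # flag_list F) \<subseteq> L"
      using flag_list(1)[OF F] F ambient_flat by (auto simp: mem_order_complex below_def)
    ultimately have "?xs ! k \<noteq> {}" using flatD(1) by auto
    moreover have "finite (restriction (localization A (?xs ! Suc k)) (?xs ! k))"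
      unfolding restriction_def localization_def using finite_hyperplanes by simp
    ultimately show ?thesis unfolding poly_0_coeff_0 by (intro coeff_0_poincare)
  qed
  then show ?thesis
    unfolding flag_poincare_def Let_def poly_0_coeff_0[symmetric] poly_prod by (intro prod.neutral) blast
qed

text \<open>All factors of the flag Poincare polynomials have constant coefficient 1.\<close>
lemma cfHP_at_0: "poly (cfHP V A) 0 = (\<Sum>F \<in> flags V. (fps_X / (1 - fps_X)) ^ card F)"
proof -
  have "coeff (map_poly fps_const (flag_poincare V A F)) 0 = 1" if "F \<in> flags V" for F
    using coeff_0_flag_poincare[OF that] by (simp add: coeff_map_poly)
  then show ?thesis
    unfolding cfHP_def proper_flats_eq_below poly_0_coeff_0 coeff_sum by (intro sum.cong) simp_all
qed

lemma cfHP_numerator_eq: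
  "cfHP_numerator V A = (\<Sum>F \<in> flags V.
     smult (face_weight (depth V) (card F)) (map_poly (\<lambda>c. [:c:]) (flag_poincare V A F)))"
  (is "_ = ?N")
proof -
  let ?r = "depth V"
  have cN: "coeff ?N i = (\<Sum>F \<in> flags V. face_weight ?r (card F) * [:coeff (flag_poincare V A F) i:])" for i
    by (simp add: coeff_sum coeff_map_poly)
  have eq: "cfHP V A = smult (1 / (1 - fps_X) ^ ?r) (map_poly fps_of_poly ?N)"
  proof (rule poly_eqI)
    fix i
    have "coeff (cfHP V A) i =
        (\<Sum>F \<in> flags V. (fps_X / (1 - fps_X)) ^ card F * fps_const (coeff (flag_poincare V A F) i))"
      unfolding cfHP_def proper_flats_eq_below by (simp add: coeff_sum coeff_map_poly)
    also have "\<dots> = (\<Sum>F \<in> flags V. 1 / (1 - fps_X) ^ ?r *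
        fps_of_poly (face_weight ?r (card F) * [:coeff (flag_poincare V A F) i:]))"
      by (intro sum.cong refl)
        (simp add: power_geometric_fps[OF card_flag_le_depth] fps_of_poly_mult fps_of_poly_const mult.assoc)
    also have "\<dots> = 1 / (1 - fps_X) ^ ?r * fps_of_poly (coeff ?N i)"
      unfolding cN fps_of_poly_sum sum_distrib_left ..
    finally show "coeff (cfHP V A) i = coeff (smult (1 / (1 - fps_X) ^ ?r) (map_poly fps_of_poly ?N)) i"
      by (simp add: coeff_map_poly)
  qed
  have ne: "1 / (1 - fps_X) ^ ?r \<noteq> (0 :: rat fps)"
    by (subst fps_divide_unit) (auto simp: fps_inverse_power)
  show ?thesis unfolding cfHP_numerator_def arr_rank_eq_depth
  proof (rule the_equality, rule eq)
    fix N assume N: "cfHP V A = smult (1 / (1 - fps_X) ^ ?r) (map_poly fps_of_poly N)"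
    show "N = ?N"
    proof (rule poly_eqI)
      fix i
      have "1 / (1 - fps_X) ^ ?r * fps_of_poly (coeff N i) =
          1 / (1 - fps_X) ^ ?r * fps_of_poly (coeff ?N i)"
        using arg_cong[OF trans[OF N[symmetric] eq], of "\<lambda>p. coeff p i"]
        by (simp only: coeff_smult coeff_map_poly fps_of_poly_0)
      then show "coeff N i = coeff ?N i"
        using ne by (simp only: mult_cancel_left fps_of_poly_eq_iff) simp
    qed
  qed
qed

text \<open>At \<open>T = 0\<close> the weight of a nonempty flag vanishes.\<close>
lemma cfHP_numerator_at_T_0: "map_poly (\<lambda>p. poly p 0) (cfHP_numerator V A) = poincare V A"
proof (rule poly_eqI)
  fix i
  have "finite F" if "F \<in> flags V" for F using that by (simp add: mem_order_complex)
  then have w: "poly (face_weight (depth V) (card F)) 0 = (if F = {} then 1 else 0)" if "F \<in> flags V" for F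
    using that by (simp add: face_weight_def power_0_left card_eq_0_iff)
  have "coeff (map_poly (\<lambda>p. poly p 0) (cfHP_numerator V A)) i =
      (\<Sum>F \<in> flags V. poly (face_weight (depth V) (card F)) 0 * coeff (flag_poincare V A F) i)"
    unfolding cfHP_numerator_eq by (simp add: coeff_map_poly coeff_sum poly_sum mult.commute)
  also have "\<dots> = (\<Sum>F \<in> flags V. if F = {} then coeff (flag_poincare V A F) i else 0)"
    using w by (intro sum.cong) auto
  also have "\<dots> = coeff (poincare V A) i"
    using finite_flags by (simp add: flag_poincare_empty empty_flag)
  finally show "coeff (map_poly (\<lambda>p. poly p 0) (cfHP_numerator V A)) i = coeff (poincare V A) i" .
qed

lemma cfHP_numerator_at_Y_0: "poly (cfHP_numerator V A) 0 = h_poly V"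
  unfolding cfHP_numerator_eq h_poly_def h_sum_def poly_0_coeff_0 coeff_sum
  by (intro sum.cong refl) (simp add: coeff_map_poly coeff_0_flag_poincare)

end


section \<open>Stanley-Reisner rings\<close>

lemma keys_plus_nat:
  fixes a b :: "'v \<Rightarrow>\<^sub>0 nat"
  shows "Poly_Mapping.keys (a + b) = Poly_Mapping.keys a \<union> Poly_Mapping.keys b"
  by (auto simp: in_keys_iff lookup_add)

lemma poly_mapping_sum_singles:
  fixes p :: "'m \<Rightarrow>\<^sub>0 'a::comm_monoid_add"
  shows "p = (\<Sum>m \<in> Poly_Mapping.keys p. Poly_Mapping.single m (Poly_Mapping.lookup p m))"
  by (rule poly_mapping_eqI) (simp add: lookup_sum lookup_single when_def in_keys_iff)

definition squarefree_monomial :: "'v set \<Rightarrow> 'v \<Rightarrow>\<^sub>0 nat" where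
  "squarefree_monomial \<sigma> = (\<Sum>v \<in> \<sigma>. Poly_Mapping.single v 1)"

lemma lookup_squarefree_monomial:
  "finite \<sigma> \<Longrightarrow> Poly_Mapping.lookup (squarefree_monomial \<sigma>) v = (if v \<in> \<sigma> then 1 else 0)"
  by (simp add: squarefree_monomial_def lookup_sum lookup_single when_def)

lemma keys_squarefree_monomial: "finite \<sigma> \<Longrightarrow> Poly_Mapping.keys (squarefree_monomial \<sigma>) = \<sigma>"
  by (auto simp: in_keys_iff lookup_squarefree_monomial split: if_splits)

lemma prod_var:
  assumes "finite \<sigma>"
  shows "(\<Prod>v \<in> \<sigma>. var v :: ('v, 'f::field) mvpoly) = Poly_Mapping.single (squarefree_monomial \<sigma>) 1"
  using assms unfolding squarefree_monomial_def
  by (induction \<sigma> rule: finite_induct) (simp_all add: var_def mult_single)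

lemma poly_ring_simps:
  "p \<otimes>\<^bsub>poly_ring W\<^esub> q = p * q" "p \<oplus>\<^bsub>poly_ring W\<^esub> q = p + q"
  "\<one>\<^bsub>poly_ring W\<^esub> = 1" "\<zero>\<^bsub>poly_ring W\<^esub> = 0"
  "p \<in> carrier (poly_ring W) \<longleftrightarrow> (\<forall>m \<in> Poly_Mapping.keys p. Poly_Mapping.keys m \<subseteq> W)"
  by (simp_all add: poly_ring_def)

lemma cring_poly_ring: "cring (poly_ring W :: ('v, 'f::field) mvpoly ring)"
proof -
  let ?C = "carrier (poly_ring W :: ('v, 'f) mvpoly ring)"
  have plus: "p + q \<in> ?C" if "p \<in> ?C" "q \<in> ?C" for p q
    using that keys_add[of p q] unfolding poly_ring_simps by blast
  have times: "p * q \<in> ?C" if pq: "p \<in> ?C" "q \<in> ?C" for p q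
    unfolding poly_ring_simps
  proof
    fix m assume "m \<in> Poly_Mapping.keys (p * q)"
    then obtain a b where "m = a + b" "a \<in> Poly_Mapping.keys p" "b \<in> Poly_Mapping.keys q"
      using keys_mult[of p q] by blast
    then show "Poly_Mapping.keys m \<subseteq> W" using pq by (simp add: poly_ring_simps keys_plus_nat)
  qed
  show ?thesis
  proof (rule cringI)
    show "abelian_group (poly_ring W :: ('v, 'f) mvpoly ring)"
    proof (rule abelian_groupI, unfold poly_ring_simps(1-4))
      show "\<exists>q \<in> ?C. q + p = 0" if "p \<in> ?C" for p
        using that by (intro bexI[of _ "- p"]) (simp_all add: poly_ring_simps)
      show "0 \<in> ?C" by (simp add: poly_ring_simps)
    qed (simp_all add: plus add_ac)
    show "comm_monoid (poly_ring W :: ('v, 'f) mvpoly ring)"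
    proof (rule comm_monoidI, unfold poly_ring_simps(1-4))
      show "1 \<in> ?C" by (simp add: poly_ring_simps)
    qed (simp_all add: times mult_ac)
  qed (simp add: poly_ring_simps distrib_right)
qed

text \<open>The monomials of degree \<open>n\<close> in which exactly the variables of \<open>\<sigma>\<close> occur.\<close>
definition monomials :: "'v set \<Rightarrow> nat \<Rightarrow> ('v \<Rightarrow>\<^sub>0 nat) set" where
  "monomials \<sigma> n = {m. Poly_Mapping.keys m = \<sigma> \<and> (\<Sum>v \<in> Poly_Mapping.keys m. Poly_Mapping.lookup m v) = n}"

locale finite_simplicial_complex =
  fixes \<Delta> :: "'v set set"
  assumes finite_complex: "finite \<Delta>"
    and finite_face: "\<sigma> \<in> \<Delta> \<Longrightarrow> finite \<sigma>"
    and face_subset: "\<lbrakk>\<sigma> \<in> \<Delta>; \<tau> \<subseteq> \<sigma>\<rbrakk> \<Longrightarrow> \<tau> \<in> \<Delta>"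
    and empty_face: "{} \<in> \<Delta>"
begin

text \<open>The explicit form of the Stanley-Reisner ideal, see \<open>sr_ideal_eq\<close>.\<close>
definition nonface_polys :: "('v, 'f::field) mvpoly set" where
  "nonface_polys = {p \<in> carrier (poly_ring (\<Union>\<Delta>)). \<forall>m \<in> Poly_Mapping.keys p. Poly_Mapping.keys m \<notin> \<Delta>}"

text \<open>Multiplication enlarges the supports of monomials, and a set that contains a nonface is a nonface.\<close>
lemma ideal_nonface_polys: "ideal (nonface_polys :: ('v, 'f::field) mvpoly set) (poly_ring (\<Union>\<Delta>))"
proof -
  let ?R = "poly_ring (\<Union>\<Delta>) :: ('v, 'f) mvpoly ring"
  let ?I = "nonface_polys :: ('v, 'f) mvpoly set"
  interpret R: cring ?R by (rule cring_poly_ring)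
  have neg: "\<ominus>\<^bsub>?R\<^esub> p = - p" if "p \<in> carrier ?R" for p
    using that by (intro R.sum_zero_eq_neg[symmetric, of "- p" p]) (simp_all add: poly_ring_simps)
  have mult: "x \<otimes>\<^bsub>?R\<^esub> a \<in> ?I" if a: "a \<in> ?I" and x: "x \<in> carrier ?R" for a x
  proof -
    have "Poly_Mapping.keys m \<notin> \<Delta>" if "m \<in> Poly_Mapping.keys (x * a)" for m
    proof -
      obtain k l where "m = k + l" "l \<in> Poly_Mapping.keys a" using \<open>m \<in> _\<close> keys_mult[of x a] by blast
      then show ?thesis using a face_subset[of "Poly_Mapping.keys m" "Poly_Mapping.keys l"]
        by (auto simp: nonface_polys_def keys_plus_nat)
    qed
    moreover have "x \<otimes>\<^bsub>?R\<^esub> a \<in> carrier ?R" using a x by (simp add: nonface_polys_def)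
    ultimately show ?thesis unfolding nonface_polys_def by (simp add: poly_ring_simps)
  qed
  show ?thesis
  proof (rule idealI)
    show "subgroup ?I (add_monoid ?R)"
    proof (rule R.add.subgroupI)
      show "?I \<subseteq> carrier ?R" by (auto simp: nonface_polys_def)
      have "0 \<in> ?I" by (simp add: nonface_polys_def poly_ring_simps)
      then show "?I \<noteq> {}" by blast
      fix p assume p: "p \<in> ?I"
      then show "\<ominus>\<^bsub>?R\<^esub> p \<in> ?I"
        by (subst neg) (simp_all add: nonface_polys_def poly_ring_simps)
      fix q assume q: "q \<in> ?I"
      have "p \<oplus>\<^bsub>?R\<^esub> q \<in> carrier ?R" using p q by (simp add: nonface_polys_def)
      then show "p \<oplus>\<^bsub>?R\<^esub> q \<in> ?I"
        using p q keys_add[of p q] unfolding nonface_polys_def by (auto simp: poly_ring_simps)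
    qed
  qed (use mult R.ring_axioms R.m_comm in \<open>auto simp: nonface_polys_def\<close>)
qed

text \<open>A monomial is divisible by the product of the variables that occur in it.\<close>
lemma single_nonface_mem_sr_ideal:
  fixes c :: "'f::field"
  assumes m: "Poly_Mapping.keys m \<subseteq> \<Union>\<Delta>" "Poly_Mapping.keys m \<notin> \<Delta>"
  shows "Poly_Mapping.single m c \<in> sr_ideal \<Delta>"
proof -
  let ?R = "poly_ring (\<Union>\<Delta>) :: ('v, 'f) mvpoly ring"
  interpret R: cring ?R by (rule cring_poly_ring)
  let ?G = "{\<Prod>v \<in> \<sigma>. var v | \<sigma>. finite \<sigma> \<and> \<sigma> \<subseteq> \<Union>\<Delta> \<and> \<sigma> \<notin> \<Delta>} :: ('v, 'f) mvpoly set"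
  have G: "?G \<subseteq> carrier ?R"
  proof
    fix p assume "p \<in> ?G"
    then obtain \<sigma> where \<sigma>: "finite \<sigma>" "\<sigma> \<subseteq> \<Union>\<Delta>" "p = (\<Prod>v \<in> \<sigma>. var v)" by blast
    then show "p \<in> carrier ?R"
      unfolding \<sigma>(3) prod_var[OF \<sigma>(1)] poly_ring_simps by (simp add: keys_squarefree_monomial)
  qed
  let ?\<sigma> = "Poly_Mapping.keys m"
  have "m - squarefree_monomial ?\<sigma> + squarefree_monomial ?\<sigma> = m"
    by (rule poly_mapping_eqI) (simp add: lookup_add lookup_minus lookup_squarefree_monomial in_keys_iff)
  then have eq: "Poly_Mapping.single m c = Poly_Mapping.single (m - squarefree_monomial ?\<sigma>) c * (\<Prod>v \<in> ?\<sigma>. var v)"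
    by (simp add: prod_var mult_single)
  have "(\<Prod>v \<in> ?\<sigma>. var v) \<in> ?G" using m finite_keys[of m] by (intro CollectI exI[of _ ?\<sigma>]) simp
  then have gen: "(\<Prod>v \<in> ?\<sigma>. var v :: ('v, 'f) mvpoly) \<in> sr_ideal \<Delta>"
    unfolding sr_ideal_def by (rule subsetD[OF R.genideal_self[OF G]])
  have "Poly_Mapping.keys (m - squarefree_monomial ?\<sigma>) \<subseteq> ?\<sigma>" by (auto simp: in_keys_iff lookup_minus)
  then have "Poly_Mapping.single (m - squarefree_monomial ?\<sigma>) c \<in> carrier ?R" using m(1) by (auto simp: poly_ring_simps)
  moreover have "ideal (sr_ideal \<Delta>) ?R" unfolding sr_ideal_def by (rule R.genideal_ideal[OF G])
  ultimately have "Poly_Mapping.single (m - squarefree_monomial ?\<sigma>) c \<otimes>\<^bsub>?R\<^esub> (\<Prod>v \<in> ?\<sigma>. var v) \<in> sr_ideal \<Delta>"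
    using gen by (intro ideal.I_l_closed)
  then show ?thesis unfolding eq by (simp add: poly_ring_simps)
qed

lemma sr_ideal_eq: "(sr_ideal \<Delta> :: ('v, 'f::field) mvpoly set) = nonface_polys"
proof
  let ?R = "poly_ring (\<Union>\<Delta>) :: ('v, 'f) mvpoly ring"
  interpret R: cring ?R by (rule cring_poly_ring)
  let ?G = "{\<Prod>v \<in> \<sigma>. var v | \<sigma>. finite \<sigma> \<and> \<sigma> \<subseteq> \<Union>\<Delta> \<and> \<sigma> \<notin> \<Delta>} :: ('v, 'f) mvpoly set"
  have G: "?G \<subseteq> nonface_polys"
  proof
    fix p assume "p \<in> ?G"
    then obtain \<sigma> where \<sigma>: "finite \<sigma>" "\<sigma> \<subseteq> \<Union>\<Delta>" "\<sigma> \<notin> \<Delta>" "p = (\<Prod>v \<in> \<sigma>. var v)" by blast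
    then show "p \<in> nonface_polys"
      unfolding \<sigma>(4) prod_var[OF \<sigma>(1)] nonface_polys_def
      by (simp add: poly_ring_simps keys_squarefree_monomial)
  qed
  then show "sr_ideal \<Delta> \<subseteq> (nonface_polys :: ('v, 'f) mvpoly set)"
    unfolding sr_ideal_def by (rule R.genideal_minimal[OF ideal_nonface_polys])
  have "?G \<subseteq> carrier ?R" using G by (auto simp: nonface_polys_def)
  then have "ideal (sr_ideal \<Delta>) ?R" unfolding sr_ideal_def by (rule R.genideal_ideal)
  then interpret I: ideal "sr_ideal \<Delta>" ?R .
  show "nonface_polys \<subseteq> (sr_ideal \<Delta> :: ('v, 'f) mvpoly set)"
  proof
    fix p :: "('v, 'f) mvpoly" assume p: "p \<in> nonface_polys"
    have "(\<Sum>m \<in> M. Poly_Mapping.single m (Poly_Mapping.lookup p m)) \<in> sr_ideal \<Delta>"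
      if "finite M" "M \<subseteq> Poly_Mapping.keys p" for M
      using that
    proof (induction M rule: finite_induct)
      case empty
      then show ?case using I.zero_closed by (simp add: poly_ring_simps)
    next
      case (insert m M)
      have "Poly_Mapping.single m (Poly_Mapping.lookup p m) \<in> sr_ideal \<Delta>"
        using insert.prems p by (intro single_nonface_mem_sr_ideal) (auto simp: nonface_polys_def poly_ring_simps)
      then show ?case using I.a_closed[of "Poly_Mapping.single m (Poly_Mapping.lookup p m)"] insert
        by (simp add: poly_ring_simps)
    qed
    then show "p \<in> sr_ideal \<Delta>" using poly_mapping_sum_singles[of p] by (metis finite_keys order_refl)
  qed
qed

lemma ideal_sr_ideal: "ideal (sr_ideal \<Delta> :: ('v, 'f::field) mvpoly set) (poly_ring (\<Union>\<Delta>))"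
  unfolding sr_ideal_eq by (rule ideal_nonface_polys)

lemma sr_class_hom:
  "ring_hom_ring (poly_ring (\<Union>\<Delta>)) (sr_ring \<Delta>) (sr_class \<Delta> :: ('v, 'f::field) mvpoly \<Rightarrow> _)"
proof -
  have "(sr_class \<Delta> :: ('v, 'f) mvpoly \<Rightarrow> _) = a_r_coset (poly_ring (\<Union>\<Delta>)) (sr_ideal \<Delta>)"
    by (rule ext) (simp add: sr_class_def)
  then show ?thesis unfolding sr_ring_def using ideal.rcos_ring_hom_ring[OF ideal_sr_ideal] by simp
qed

lemma sr_class_eq_iff:
  fixes p q :: "('v, 'f::field) mvpoly"
  assumes pq: "p \<in> carrier (poly_ring (\<Union>\<Delta>))" "q \<in> carrier (poly_ring (\<Union>\<Delta>))"
  shows "sr_class \<Delta> p = sr_class \<Delta> q \<longleftrightarrow> p - q \<in> nonface_polys"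
proof -
  let ?R = "poly_ring (\<Union>\<Delta>) :: ('v, 'f) mvpoly ring"
  interpret R: cring ?R by (rule cring_poly_ring)
  have "\<ominus>\<^bsub>?R\<^esub> q = - q"
    using pq(2) by (intro R.sum_zero_eq_neg[symmetric, of "- q" q]) (simp_all add: poly_ring_simps)
  then have "p \<ominus>\<^bsub>?R\<^esub> q = p - q" unfolding a_minus_def by (simp add: poly_ring_simps)
  then show ?thesis
    using R.quotient_eq_iff_same_a_r_cos[OF ideal_sr_ideal pq] unfolding sr_class_def sr_ideal_eq by simp
qed

abbreviation face_monomials :: "('v \<Rightarrow>\<^sub>0 nat) set" where
  "face_monomials \<equiv> {m. Poly_Mapping.keys m \<in> \<Delta>}"

lemma face_supported_carrier:
  "Poly_Mapping.keys p \<subseteq> face_monomials \<Longrightarrow> p \<in> carrier (poly_ring (\<Union>\<Delta>))"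
  by (auto simp: poly_ring_simps)

lemma subfield_sr_scalars:
  "subfield (sr_scalars \<Delta>) (sr_ring \<Delta> :: ('v, 'f::field) mvpoly set ring)"
proof -
  let ?R = "poly_ring (\<Union>\<Delta>) :: ('v, 'f) mvpoly ring"
  let ?K = "{Poly_Mapping.single 0 c | c. True} :: ('v, 'f) mvpoly set"
  interpret R: cring ?R by (rule cring_poly_ring)
  interpret h: ring_hom_ring ?R "sr_ring \<Delta>" "sr_class \<Delta> :: ('v, 'f) mvpoly \<Rightarrow> _" by (rule sr_class_hom)
  have "field (?R \<lparr>carrier := ?K\<rparr>)"
  proof (rule cring.cring_fieldI2)
    show "cring (?R \<lparr>carrier := ?K\<rparr>)"
    proof (rule R.subcring_iff[THEN iffD1])
      show "subcring ?K ?R"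
      proof (rule R.subcringI'[OF R.subringI])
        show "?K \<subseteq> carrier ?R" by (auto simp: poly_ring_simps)
        show "\<one>\<^bsub>?R\<^esub> \<in> ?K" by (auto simp: poly_ring_simps intro!: exI[of _ 1])
        fix p assume "p \<in> ?K"
        then obtain c where p: "p = Poly_Mapping.single 0 c" by blast
        have "\<ominus>\<^bsub>?R\<^esub> p = Poly_Mapping.single 0 (- c)"
          unfolding p by (intro R.sum_zero_eq_neg[symmetric]) (simp_all add: poly_ring_simps single_uminus)
        then show "\<ominus>\<^bsub>?R\<^esub> p \<in> ?K" by blast
        fix q assume "q \<in> ?K"
        then obtain e where q: "q = Poly_Mapping.single 0 e" by blast
        have "p \<otimes>\<^bsub>?R\<^esub> q = Poly_Mapping.single 0 (c * e)" "p \<oplus>\<^bsub>?R\<^esub> q = Poly_Mapping.single 0 (c + e)"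
          unfolding p q by (simp_all add: poly_ring_simps mult_single single_add)
        then show "p \<otimes>\<^bsub>?R\<^esub> q \<in> ?K" "p \<oplus>\<^bsub>?R\<^esub> q \<in> ?K" by blast+
      qed
    qed (auto simp: poly_ring_simps)
    show "\<zero>\<^bsub>?R \<lparr>carrier := ?K\<rparr>\<^esub> \<noteq> \<one>\<^bsub>?R \<lparr>carrier := ?K\<rparr>\<^esub>" by (simp add: poly_ring_simps)
    fix a assume "a \<in> carrier (?R \<lparr>carrier := ?K\<rparr>)" "a \<noteq> \<zero>\<^bsub>?R \<lparr>carrier := ?K\<rparr>\<^esub>"
    then obtain c where a: "a = Poly_Mapping.single 0 c" and "a \<noteq> 0" by (auto simp: poly_ring_simps)
    then have "c \<noteq> 0" by auto
    with a show "\<exists>b \<in> carrier (?R \<lparr>carrier := ?K\<rparr>).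
        a \<otimes>\<^bsub>?R \<lparr>carrier := ?K\<rparr>\<^esub> b = \<one>\<^bsub>?R \<lparr>carrier := ?K\<rparr>\<^esub>"
      by (intro bexI[of _ "Poly_Mapping.single 0 (inverse c)"]) (auto simp: poly_ring_simps mult_single)
  qed
  moreover have "?K \<subseteq> carrier ?R" by (auto simp: poly_ring_simps)
  ultimately have K: "subfield ?K ?R" by (rule R.subfield_iff(1))
  have "sr_class \<Delta> (1 :: ('v, 'f) mvpoly) \<noteq> sr_class \<Delta> 0"
    using empty_face by (subst sr_class_eq_iff) (auto simp: poly_ring_simps nonface_polys_def)
  then have "\<one>\<^bsub>sr_ring \<Delta>\<^esub> \<noteq> \<zero>\<^bsub>sr_ring \<Delta> :: ('v, 'f) mvpoly set ring\<^esub>"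
    using h.hom_one h.hom_zero by (simp add: poly_ring_simps)
  from h.img_is_subfield(2)[OF K this] show ?thesis unfolding sr_scalars_def .
qed

text \<open>
  The classes of the face monomials are linearly independent, because a nonzero element of the ideal has
  only nonface monomials. Adding one monomial to \<open>S\<close> at a time matches the inductive definition of
  \<open>dimension\<close>.
\<close>
lemma dimension_face_supported:
  assumes "finite S" "S \<subseteq> face_monomials"
  shows "ring.dimension (sr_ring \<Delta> :: ('v, 'f::field) mvpoly set ring) (card S) (sr_scalars \<Delta>)
    (sr_class \<Delta> ` {p. Poly_Mapping.keys p \<subseteq> S})"
  using assms
proof (induction S rule: finite_induct)
  case empty
  interpret h: ring_hom_ring "poly_ring (\<Union>\<Delta>)" "sr_ring \<Delta>" "sr_class \<Delta> :: ('v, 'f) mvpoly \<Rightarrow> _"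
    by (rule sr_class_hom)
  have "sr_class \<Delta> ` {p :: ('v, 'f) mvpoly. Poly_Mapping.keys p \<subseteq> {}} = {\<zero>\<^bsub>sr_ring \<Delta>\<^esub>}"
    using h.hom_zero by (simp add: poly_ring_simps)
  then show ?case by (simp only: card.empty h.S.dimension.zero_dim)
next
  case (insert m S)
  let ?R = "poly_ring (\<Union>\<Delta>) :: ('v, 'f) mvpoly ring"
  interpret h: ring_hom_ring ?R "sr_ring \<Delta>" "sr_class \<Delta> :: ('v, 'f) mvpoly \<Rightarrow> _" by (rule sr_class_hom)
  let ?v = "sr_class \<Delta> (Poly_Mapping.single m (1 :: 'f))"
  let ?E = "\<lambda>S. sr_class \<Delta> ` {p :: ('v, 'f) mvpoly. Poly_Mapping.keys p \<subseteq> S}"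
  have S: "S \<subseteq> face_monomials" and mf: "Poly_Mapping.keys m \<in> \<Delta>" using insert.prems by auto
  have mc: "Poly_Mapping.single m c \<in> carrier ?R" for c
    using mf by (intro face_supported_carrier) simp
  have kc: "Poly_Mapping.single 0 c \<in> carrier ?R" for c by (simp add: poly_ring_simps)
  have qc: "q \<in> carrier ?R" if "Poly_Mapping.keys q \<subseteq> S" for q
    using that S by (intro face_supported_carrier) blast
  have "?v \<notin> ?E S"
  proof
    assume "?v \<in> ?E S"
    then obtain p :: "('v, 'f) mvpoly" where p: "Poly_Mapping.keys p \<subseteq> S" "?v = sr_class \<Delta> p" by blast
    then have "Poly_Mapping.single m 1 - p \<in> nonface_polys" using sr_class_eq_iff[OF mc qc] by blast
    moreover have "Poly_Mapping.lookup p m = 0" using p(1) insert.hyps(2) by (auto simp: in_keys_iff)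
    then have "m \<in> Poly_Mapping.keys (Poly_Mapping.single m 1 - p)" by (simp add: in_keys_iff lookup_minus)
    ultimately show False using mf unfolding nonface_polys_def by blast
  qed
  moreover have "?v \<in> carrier (sr_ring \<Delta>)" using mc by (rule h.hom_closed)
  ultimately have "ring.dimension (sr_ring \<Delta>) (Suc (card S)) (sr_scalars \<Delta>)
      (ring.line_extension (sr_ring \<Delta>) (sr_scalars \<Delta>) ?v (?E S))"
    using insert.IH[OF S] by (intro h.S.dimension.Suc_dim)
  moreover have "ring.line_extension (sr_ring \<Delta>) (sr_scalars \<Delta>) ?v (?E S) = ?E (insert m S)"
  proof -
    have combine: "sr_class \<Delta> (Poly_Mapping.single 0 c) \<otimes>\<^bsub>sr_ring \<Delta>\<^esub> ?v \<oplus>\<^bsub>sr_ring \<Delta>\<^esub> sr_class \<Delta> q =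
        sr_class \<Delta> (Poly_Mapping.single m c + q)" if q: "Poly_Mapping.keys q \<subseteq> S" for c q
    proof -
      have "sr_class \<Delta> (Poly_Mapping.single 0 c) \<otimes>\<^bsub>sr_ring \<Delta>\<^esub> ?v =
          sr_class \<Delta> (Poly_Mapping.single 0 c \<otimes>\<^bsub>?R\<^esub> Poly_Mapping.single m 1)"
        by (rule h.hom_mult[OF kc mc, symmetric])
      also have "Poly_Mapping.single 0 c \<otimes>\<^bsub>?R\<^esub> Poly_Mapping.single m 1 = Poly_Mapping.single m c"
        by (simp add: poly_ring_simps mult_single)
      finally show ?thesis using h.hom_add[OF mc qc[OF q]] by (simp add: poly_ring_simps)
    qed
    show ?thesis
    proof (rule Set.set_eqI, rule iffI)
      fix u assume "u \<in> ring.line_extension (sr_ring \<Delta>) (sr_scalars \<Delta>) ?v (?E S)"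
      then obtain c q where q: "Poly_Mapping.keys q \<subseteq> S" and u: "u = sr_class \<Delta> (Poly_Mapping.single m c + q)"
        unfolding h.S.line_extension_mem_iff sr_scalars_def using combine by auto
      have "Poly_Mapping.keys (Poly_Mapping.single m c + q) \<subseteq> insert m S"
        using keys_add[of "Poly_Mapping.single m c" q] q by (auto split: if_splits)
      then show "u \<in> ?E (insert m S)" using u by blast
    next
      fix u assume "u \<in> ?E (insert m S)"
      then obtain p where p: "Poly_Mapping.keys p \<subseteq> insert m S" "u = sr_class \<Delta> p" by blast
      let ?c = "Poly_Mapping.lookup p m"
      let ?q = "p - Poly_Mapping.single m ?c"
      have q: "Poly_Mapping.keys ?q \<subseteq> S"
        using p(1) by (auto simp: in_keys_iff lookup_minus lookup_single when_def split: if_splits)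
      have "u = sr_class \<Delta> (Poly_Mapping.single 0 ?c) \<otimes>\<^bsub>sr_ring \<Delta>\<^esub> ?v \<oplus>\<^bsub>sr_ring \<Delta>\<^esub> sr_class \<Delta> ?q"
        unfolding combine[OF q] using p(2) by simp
      then show "u \<in> ring.line_extension (sr_ring \<Delta>) (sr_scalars \<Delta>) ?v (?E S)"
        unfolding h.S.line_extension_mem_iff sr_scalars_def using q by blast
    qed
  qed
  ultimately show ?case using insert.hyps by simp
qed

text \<open>Dropping the nonface monomials of a polynomial does not change its class.\<close>
lemma sr_component_eq:
  "sr_component \<Delta> n = sr_class \<Delta> `
    {p :: ('v, 'f::field) mvpoly. Poly_Mapping.keys p \<subseteq> (\<Union>\<sigma> \<in> \<Delta>. monomials \<sigma> n)}"
proof -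
  let ?S = "\<Union>\<sigma> \<in> \<Delta>. monomials \<sigma> n"
  have "\<exists>q. Poly_Mapping.keys q \<subseteq> ?S \<and> sr_class \<Delta> p = sr_class \<Delta> q"
    if p: "p \<in> homogeneous (\<Union>\<Delta>) n" for p :: "('v, 'f) mvpoly"
  proof -
    define q where "q = (\<Sum>m \<in> Poly_Mapping.keys p \<inter> ?S. Poly_Mapping.single m (Poly_Mapping.lookup p m))"
    have look: "Poly_Mapping.lookup q m = (if m \<in> ?S then Poly_Mapping.lookup p m else 0)" for m
      unfolding q_def by (simp add: lookup_sum lookup_single when_def in_keys_iff)
    then have q: "Poly_Mapping.keys q \<subseteq> ?S" by (auto simp: in_keys_iff split: if_splits)
    have "Poly_Mapping.keys m \<notin> \<Delta>" "m \<in> Poly_Mapping.keys p" if "m \<in> Poly_Mapping.keys (p - q)" for m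
    proof -
      have "m \<in> Poly_Mapping.keys p" "m \<notin> ?S"
        using that look[of m] by (auto simp: in_keys_iff lookup_minus split: if_splits)
      then show "Poly_Mapping.keys m \<notin> \<Delta>" "m \<in> Poly_Mapping.keys p"
        using p by (auto simp: homogeneous_def monomials_def)
    qed
    then have "p - q \<in> nonface_polys"
      using p unfolding nonface_polys_def homogeneous_def poly_ring_simps by auto
    moreover have "q \<in> carrier (poly_ring (\<Union>\<Delta>))"
      using q by (intro face_supported_carrier) (auto simp: monomials_def)
    moreover have "p \<in> carrier (poly_ring (\<Union>\<Delta>))" using p by (simp add: homogeneous_def)
    ultimately show ?thesis using sr_class_eq_iff q by blast
  qed
  moreover have "p \<in> homogeneous (\<Union>\<Delta>) n" if "Poly_Mapping.keys p \<subseteq> ?S" for p :: "('v, 'f) mvpoly"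
    using that by (fastforce simp: homogeneous_def poly_ring_simps monomials_def)
  ultimately show ?thesis unfolding sr_component_def by blast
qed

end


section \<open>Hilbert series\<close>

lemma monomials_empty: "monomials {} n = (if n = 0 then {0} else {})"
  by (auto simp: monomials_def)

text \<open>Split off the power of \<open>x\<^sub>v\<close>, whose exponent \<open>k\<close> is at least 1.\<close>
lemma monomials_insert:
  assumes v: "v \<notin> \<sigma>"
  shows "monomials (insert v \<sigma>) n =
    (\<Union>k \<in> {1..n}. (\<lambda>m. m + Poly_Mapping.single v k) ` monomials \<sigma> (n - k))"
proof (rule Set.set_eqI, rule iffI)
  fix m assume "m \<in> monomials (insert v \<sigma>) n"
  then have m: "Poly_Mapping.keys m = insert v \<sigma>" "(\<Sum>w \<in> Poly_Mapping.keys m. Poly_Mapping.lookup m w) = n"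
    by (auto simp: monomials_def)
  then have fin: "finite \<sigma>" by (metis finite_insert finite_keys)
  let ?k = "Poly_Mapping.lookup m v"
  let ?m = "m - Poly_Mapping.single v ?k"
  have look: "Poly_Mapping.lookup ?m w = (if w = v then 0 else Poly_Mapping.lookup m w)" for w
    by (simp add: lookup_minus lookup_single when_def)
  have "Poly_Mapping.keys ?m = \<sigma>"
    using m(1) v look by (auto simp: in_keys_iff set_eq_iff split: if_splits)
  moreover have total: "n = ?k + (\<Sum>w \<in> \<sigma>. Poly_Mapping.lookup m w)"
    using m fin v by simp
  moreover have "(\<Sum>w \<in> \<sigma>. Poly_Mapping.lookup ?m w) = (\<Sum>w \<in> \<sigma>. Poly_Mapping.lookup m w)"
    using v look by (intro sum.cong) auto
  ultimately have "?m \<in> monomials \<sigma> (n - ?k)" by (simp add: monomials_def)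
  moreover have "?k \<noteq> 0" using m(1) by (metis in_keys_iff insertI1)
  then have "?k \<in> {1..n}" using total by simp
  moreover have "m = ?m + Poly_Mapping.single v ?k"
    by (rule poly_mapping_eqI) (simp add: lookup_add lookup_minus lookup_single when_def)
  ultimately show "m \<in> (\<Union>k \<in> {1..n}. (\<lambda>m. m + Poly_Mapping.single v k) ` monomials \<sigma> (n - k))"
    by blast
next
  fix m assume "m \<in> (\<Union>k \<in> {1..n}. (\<lambda>m. m + Poly_Mapping.single v k) ` monomials \<sigma> (n - k))"
  then obtain k m' where k: "1 \<le> k" "k \<le> n" and m': "m' \<in> monomials \<sigma> (n - k)"
    and m: "m = m' + Poly_Mapping.single v k" by auto
  have keys: "Poly_Mapping.keys m' = \<sigma>" and deg: "(\<Sum>w \<in> \<sigma>. Poly_Mapping.lookup m' w) = n - k"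
    using m' by (auto simp: monomials_def)
  have fin: "finite \<sigma>" using keys finite_keys by metis
  have "Poly_Mapping.lookup m' v = 0" using v keys by (metis in_keys_iff)
  then have "Poly_Mapping.lookup m v = k" unfolding m by (simp add: lookup_add)
  moreover have "(\<Sum>w \<in> \<sigma>. Poly_Mapping.lookup m w) = (\<Sum>w \<in> \<sigma>. Poly_Mapping.lookup m' w)"
    using v unfolding m by (intro sum.cong) (auto simp: lookup_add lookup_single when_def)
  moreover have "Poly_Mapping.keys m = insert v \<sigma>"
    unfolding m keys_plus_nat keys using k by simp
  ultimately show "m \<in> monomials (insert v \<sigma>) n"
    using fin v deg k by (simp add: monomials_def)
qed

text \<open>The variables of \<open>\<sigma>\<close> occur with independent positive exponents, and a single positive exponent has the
  generating function \<open>T + T\<^sup>2 + \<dots> = T / (1 - T)\<close>.\<close>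
lemma card_monomials:
  assumes "finite \<sigma>"
  shows "finite (monomials \<sigma> n) \<and>
    (of_nat (card (monomials \<sigma> n)) :: rat) = fps_nth ((fps_X / (1 - fps_X)) ^ card \<sigma>) n"
  using assms
proof (induction \<sigma> arbitrary: n rule: finite_induct)
  case empty
  then show ?case by (simp add: monomials_empty)
next
  case (insert v \<sigma>)
  let ?g = "\<lambda>k m. m + Poly_Mapping.single v (k :: nat)"
  let ?f = "fps_X / (1 - fps_X) :: rat fps"
  have fin: "finite (monomials \<sigma> i)" for i using insert.IH by blast
  have inj: "inj_on (?g k) X" for k X
  proof (rule inj_onI)
    fix a b assume "?g k a = ?g k b"
    then have eq: "Poly_Mapping.lookup (?g k a) w = Poly_Mapping.lookup (?g k b) w" for w by simp
    have "Poly_Mapping.lookup a w = Poly_Mapping.lookup b w" for w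
      using eq[of w] unfolding lookup_add by (rule add_right_imp_eq)
    then show "a = b" by (rule poly_mapping_eqI)
  qed
  have zero: "Poly_Mapping.lookup m v = 0" if "m \<in> monomials \<sigma> i" for m i
    using that insert.hyps(2) by (auto simp: monomials_def in_keys_iff)
  have disj: "?g k ` monomials \<sigma> (n - k) \<inter> ?g l ` monomials \<sigma> (n - l) = {}" if "k \<noteq> l" for k l
  proof (rule ccontr)
    assume "\<not> ?thesis"
    then obtain a b where ab: "a \<in> monomials \<sigma> (n - k)" "b \<in> monomials \<sigma> (n - l)"
      and eq: "?g k a = ?g l b" by blast
    have "Poly_Mapping.lookup (?g k a) v = k" using zero[OF ab(1)] by (simp add: lookup_add)
    moreover have "Poly_Mapping.lookup (?g l b) v = l" using zero[OF ab(2)] by (simp add: lookup_add)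
    ultimately show False using that eq by metis
  qed
  have f: "?f = Abs_fps (\<lambda>n. if n = 0 then 0 else 1)"
  proof -
    have "inverse (1 - fps_X :: rat fps) = Abs_fps (\<lambda>n. 1)" using fps_inverse_gp' by (metis fps_inverse_idempotent fps_inverse_gp fps_nth_Abs_fps one_neq_zero)
    then show ?thesis by (subst fps_divide_unit) (auto simp: fps_eq_iff)
  qed
  have "card (monomials (insert v \<sigma>) n) = (\<Sum>k \<in> {1..n}. card (?g k ` monomials \<sigma> (n - k)))"
    unfolding monomials_insert[OF insert.hyps(2)] using fin disj by (intro card_UN_disjoint) auto
  also have "\<dots> = (\<Sum>k \<in> {1..n}. card (monomials \<sigma> (n - k)))"
    by (intro sum.cong refl card_image inj)
  finally have "(of_nat (card (monomials (insert v \<sigma>) n)) :: rat) =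
      (\<Sum>k \<in> {1..n}. fps_nth (?f ^ card \<sigma>) (n - k))"
    using insert.IH by simp
  also have "\<dots> = (\<Sum>k \<in> {0..n}. fps_nth ?f k * fps_nth (?f ^ card \<sigma>) (n - k))"
    unfolding f by (rule sum.mono_neutral_cong_left) auto
  also have "\<dots> = fps_nth (?f ^ card (insert v \<sigma>)) n"
    using insert.hyps by (simp add: fps_mult_nth)
  finally show ?case unfolding monomials_insert[OF insert.hyps(2)] using fin by simp
qed

context finite_simplicial_complex
begin

theorem sr_hilbert_series_eq:
  "sr_hilbert_series TYPE('f::field) \<Delta> = (\<Sum>\<sigma> \<in> \<Delta>. (fps_X / (1 - fps_X)) ^ card \<sigma>)"
proof (rule fps_ext)
  fix n
  let ?S = "\<Union>\<sigma> \<in> \<Delta>. monomials \<sigma> n"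
  interpret h: ring_hom_ring "poly_ring (\<Union>\<Delta>)" "sr_ring \<Delta>" "sr_class \<Delta> :: ('v, 'f) mvpoly \<Rightarrow> _"
    by (rule sr_class_hom)
  have fin: "finite (monomials \<sigma> n)" if "\<sigma> \<in> \<Delta>" for \<sigma>
    using card_monomials finite_face[OF that] by blast
  have "h.S.dimension (card ?S) (sr_scalars \<Delta>) (sr_component \<Delta> n)"
    unfolding sr_component_eq using fin finite_complex
    by (intro dimension_face_supported) (auto simp: monomials_def)
  then have "(h.S.dim over (sr_scalars \<Delta>)) (sr_component \<Delta> n) = card ?S"
    by (rule h.S.dimI[OF subfield_sr_scalars])
  then have "fps_nth (sr_hilbert_series TYPE('f) \<Delta>) n = of_nat (card ?S)"
    unfolding sr_hilbert_series_def hilbert_series_def by simp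
  also have "card ?S = (\<Sum>\<sigma> \<in> \<Delta>. card (monomials \<sigma> n))"
    using fin finite_complex by (intro card_UN_disjoint) (auto simp: monomials_def)
  also have "of_nat \<dots> = (\<Sum>\<sigma> \<in> \<Delta>. fps_nth ((fps_X / (1 - fps_X)) ^ card \<sigma>) n :: rat)"
    unfolding of_nat_sum using card_monomials finite_face by (intro sum.cong refl) blast
  finally show "fps_nth (sr_hilbert_series TYPE('f) \<Delta>) n =
      fps_nth (\<Sum>\<sigma> \<in> \<Delta>. (fps_X / (1 - fps_X)) ^ card \<sigma>) n"
    by (simp add: fps_sum_nth)
qed

end

lemma finite_simplicial_complex_order_complex:
  "finite P \<Longrightarrow> finite_simplicial_complex (order_complex P)"
proof
  show "\<tau> \<in> order_complex P" if "\<sigma> \<in> order_complex P" "\<tau> \<subseteq> \<sigma>" for \<sigma> \<tau>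
    using that finite_subset[of \<tau> \<sigma>] unfolding mem_order_complex by blast
qed (auto simp: finite_order_complex mem_order_complex)

context affine_arrangement
begin

text \<open>The order complex of all flats is a cone with apex \<open>V\<close>.\<close>
lemma order_complex_flats: "order_complex L = flags V \<union> insert V ` flags V"
proof (rule Set.set_eqI, rule iffI)
  fix F assume F: "F \<in> order_complex L"
  then have rest: "F - {V} \<in> flags V"
    using flatD(2) by (auto simp: mem_order_complex below_def)
  show "F \<in> flags V \<union> insert V ` flags V"
  proof (cases "V \<in> F")
    case True
    then have "F = insert V (F - {V})" by blast
    then show ?thesis using rest by blast
  qed (use rest in simp)
next
  fix F assume "F \<in> flags V \<union> insert V ` flags V"
  moreover have "flags V \<subseteq> order_complex L"
    by (rule order_complex_mono) (auto simp: below_def)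
  moreover have "insert V G \<in> order_complex L" if "G \<in> flags V" for G
    using that \<open>flags V \<subseteq> _\<close> flag_Union_subset[OF that] by (intro insert_top_flag ambient_flat) auto
  ultimately show "F \<in> order_complex L" by blast
qed

text \<open>Coning multiplies the sum over all faces by \<open>1 + T / (1 - T) = 1 / (1 - T)\<close>.\<close>
lemma cfHP_hilbert_series:
  "poly (cfHP V A) 0 / (1 - fps_X) = sr_hilbert_series TYPE('f::field) (order_complex L)"
proof -
  let ?f = "fps_X / (1 - fps_X) :: rat fps"
  interpret finite_simplicial_complex "order_complex L"
    using finite_flats by (rule finite_simplicial_complex_order_complex)
  have notin: "V \<notin> F" "finite F" if "F \<in> flags V" for F
    using that by (auto simp: mem_order_complex below_def)
  have inj: "inj_on (insert V) (flags V)" using notin(1) by (meson inj_onI insert_ident)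
  have inv: "(1 - fps_X) * inverse (1 - fps_X :: rat fps) = 1"
    by (rule inverse_mult_eq_1') simp
  have geom: "1 + ?f = inverse (1 - fps_X)"
  proof -
    have "1 + ?f = (1 - fps_X) * inverse (1 - fps_X) + fps_X * inverse (1 - fps_X)"
      unfolding inv by (subst fps_divide_unit) simp_all
    also have "\<dots> = inverse (1 - fps_X)" by (simp flip: distrib_right)
    finally show ?thesis .
  qed
  have "sr_hilbert_series TYPE('f) (order_complex L) = (\<Sum>F \<in> order_complex L. ?f ^ card F)"
    by (rule sr_hilbert_series_eq)
  also have "\<dots> = (\<Sum>F \<in> flags V. ?f ^ card F) + (\<Sum>F \<in> insert V ` flags V. ?f ^ card F)"
    unfolding order_complex_flats using finite_flags notin(1)
    by (intro sum.union_disjoint) auto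
  also have "(\<Sum>F \<in> insert V ` flags V. ?f ^ card F) = (\<Sum>F \<in> flags V. ?f * ?f ^ card F)"
    using notin by (subst sum.reindex[OF inj]) (auto intro!: sum.cong)
  also have "(\<Sum>F \<in> flags V. ?f ^ card F) + \<dots> = (\<Sum>F \<in> flags V. ?f ^ card F) * (1 + ?f)"
    by (simp only: sum_distrib_right distrib_left mult_1_right mult.commute[of ?f])
  also have "\<dots> = poly (cfHP V A) 0 / (1 - fps_X)"
    unfolding geom cfHP_at_0 by (subst fps_divide_unit) simp_all
  finally show ?thesis ..
qed

end

theorem proposition1p9:
  fixes d :: nat and A :: "'k::field vec set set"
  assumes "hyperplane_arrangement d A"
  shows "map_poly (\<lambda>p. poly p 0) (cfHP_numerator (carrier_vec d) A) = poincare (carrier_vec d) A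
    \<and> poly (cfHP (carrier_vec d) A) 0 / (1 - fps_X)
        = sr_hilbert_series TYPE('f::field) (order_complex (flats (carrier_vec d) A))
    \<and> (\<forall>i. coeff (map_poly (\<lambda>p. poly p 0) (cfHP_numerator (carrier_vec d) A)) i \<ge> 0)
    \<and> (\<forall>i. coeff (poly (cfHP_numerator (carrier_vec d) A) 0) i \<ge> 0)"
proof -
  interpret affine_arrangement "carrier_vec d" A
    using assms by (rule affine_arrangement_carrier_vec)
  show ?thesis
    using cfHP_numerator_at_T_0 cfHP_hilbert_series[where ?'f = 'f] poincare_nonneg
      h_poly_nonneg[OF ambient_flat]
    unfolding cfHP_numerator_at_Y_0 coeffs_nonneg_def by simp
qed

end
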